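(* Let $\mathfrak a=\langle f_1,\dots,f_r\rangle\subset\mathbb C[\boldsymbol x]=\mathbb C[x_1,\dots,x_n]$ be an ideal with system of generators $\boldsymbol f=(f_1,\dots,f_r)$, and let $g\in\mathbb C[\boldsymbol x]$ be nonzero. Let $$I_{\boldsymbol f}=\langle t_iu_1-f_i\mid 1\le i\le r\rangle+\Big\langle u_1\partial_{x_j}+\sum_{i=1}^r\partial_{x_j}(f_i)\,\partial_{t_i}\ \Big|\ 1\le j\le n\Big\rangle+\langle u_1u_2-1\rangle,$$ a left ideal of $D_Y[u_1,u_2]$. Define successively 1. $I_{\boldsymbol f,1}=I_{\boldsymbol f}\cap D_Y$, 2. $I_{(\boldsymbol f;g),2}=D_Y[s]\,(I_{\boldsymbol f,1}+g\mathfrak a+\langle s-\sigma\rangle)\cap\mathbb C[\boldsymbol x,s]$, 3. $I_{(\boldsymbol f;g),3}=I_{(\boldsymbol f;g),2}:g=(I_{(\boldsymbol f;g),2}\cap\langle g\rangle)\cdot g^{-1}$, 4. $I_{(\boldsymbol f;g),4}=I_{(\boldsymbol f;g),3}\cap\mathbb C[s]$. Then the global generalized Bernstein–Sato polynomial $b_{\mathfrak a,g}(s)$ is the (monic) generator of the ideal $I_{(\boldsymbol f;g),4}$ of $\mathbb C[s]$.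
   Context: Rings. $D_X=\mathbb C\langle x_1,\dots,x_n,\partial_{x_1},\dots,\partial_{x_n}\rangle$ and $D_Y=\mathbb C\langle x_1,\dots,x_n,t_1,\dots,t_r,\partial_{x_1},\dots,\partial_{x_n},\partial_{t_1},\dots,\partial_{t_r}\rangle$ are the Weyl algebras in $n$ and $n+r$ variables. The letters $u_1,u_2,s$ denote new variables commuting with everything; $\langle\cdots\rangle$ denotes the left ideal generated (in $\mathbb C[\boldsymbol x,s]$, the ideal generated). $D_Y[s](I_{\boldsymbol f,1}+g\mathfrak a+\langle s-\sigma\rangle)$ is the left ideal of $D_Y[s]$ generated by $I_{\boldsymbol f,1}$, the elements of $g\mathfrak a$, and $s-\sigma$, where $\sigma=-\sum_{i=1}^r\partial_{t_i}t_i\in D_Y$. For an ideal $I$ of $\mathbb C[\boldsymbol x,s]$, $I:g=\{h\in\mathbb C[\boldsymbol x,s]\mid hg\in I\}$. The module $N_{\boldsymbol f}$. The $f_i$ are nonzero. Let $s_1,\dots,s_r$ be independent variables and $N_{\boldsymbol f}=\mathbb C[\boldsymbol x][\prod_if_i^{-1},s_1,\dots,s_r]\prod_if_i^{s_i}$, where $\prod_if_i^{s_i}$ is a formal symbol (free module of rank one). It is a left $D_Y$-module: $\mathbb C[\boldsymbol x]$ acts by multiplication, and for $h\in\mathbb C[\boldsymbol x][\prod_i f_i^{-1},s_1,\dots,s_r]$, $$\partial_{x_j}\Big(h\prod_if_i^{s_i}\Big)=\Big(\partial_{x_j}(h)+h\sum_{k=1}^rs_k\frac{\partial_{x_j}(f_k)}{f_k}\Big)\prod_if_i^{s_i},$$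 $$t_j\Big(h(x,s_1,\dots,s_r)\prod_if_i^{s_i}\Big)=h(x,s_1,\dots,s_j+1,\dots,s_r)f_j\prod_if_i^{s_i},$$ $$\partial_{t_j}\Big(h(x,s_1,\dots,s_r)\prod_if_i^{s_i}\Big)=-s_jh(x,s_1,\dots,s_j-1,\dots,s_r)f_j^{-1}\prod_if_i^{s_i}.$$ Definition of $b_{\mathfrak a,g}$. The global generalized Bernstein–Sato polynomial $b_{\mathfrak a,g}(s)\in\mathbb C[s]$ is the monic polynomial $b(s)$ of minimal degree satisfying $$b(\sigma)\,g\prod_if_i^{s_i}=\sum_{j=1}^rP_j\,g f_j\prod_if_i^{s_i}$$ for some $P_1,\dots,P_r\in D_X\langle-\partial_{t_j}t_k\mid1\le j,k\le r\rangle$ (the subalgebra of $D_Y$ generated by $D_X$ and the elements $-\partial_{t_j}t_k$). It is known (Budur–Mustaţă–Saito) that $b_{\mathfrak a,g}$ exists and does not depend on the choice of generators of $\mathfrak a$. *)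

theory Defs
  imports
    Complex_Main
    "HOL-Library.Poly_Mapping"
    "HOL-Library.Set_Algebras"
    "HOL-Computational_Algebra.Computational_Algebra"
begin

text \<open>\<open>left_ideal hull S\<close> is the left ideal generated by \<open>S\<close>. In a commutative ring
  left ideals are ideals, and the same notion is used there.\<close>

definition left_ideal :: "'a::ring_1 set \<Rightarrow> bool" where
  "left_ideal J \<longleftrightarrow> 0 \<in> J \<and> (\<forall>a\<in>J. \<forall>b\<in>J. a + b \<in> J) \<and> (\<forall>c. \<forall>a\<in>J. c * a \<in> J)"

definition two_sided_ideal :: "'a::ring_1 set \<Rightarrow> bool" where
  "two_sided_ideal J \<longleftrightarrow> left_ideal J \<and> (\<forall>c. \<forall>a\<in>J. a * c \<in> J)"

definition colon_ideal :: "'a::comm_ring_1 set \<Rightarrow> 'a \<Rightarrow> 'a set" where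
  "colon_ideal J a = {h. h * a \<in> J}"

lemma left_ideal_hull: "left_ideal (left_ideal hull S)"
  by (rule hull_in) (auto simp: left_ideal_def)

lemma two_sided_ideal_hull: "two_sided_ideal (two_sided_ideal hull S)"
  by (rule hull_in) (auto simp: two_sided_ideal_def left_ideal_def)

lemma left_ideal_diff:
  assumes "left_ideal J" "a \<in> J" "b \<in> J" shows "a - b \<in> J"
proof -
  have "a + (-1) * b \<in> J" using assms unfolding left_ideal_def by blast
  then show ?thesis by simp
qed

text \<open>The polynomial ring over the complex numbers whose variables are the elements of \<open>'v\<close>;
  \<open>Poly_Mapping.single m c\<close> is \<open>c\<close> times the monomial with exponent vector \<open>m\<close>. An order on the
  variables is required below only because the library makes this ring an integral domain
  (which the fraction field needs) for linearly ordered variables.\<close>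

type_synonym 'v cpoly = "('v \<Rightarrow>\<^sub>0 nat) \<Rightarrow>\<^sub>0 complex"

definition mvar :: "'v \<Rightarrow> ('v \<Rightarrow>\<^sub>0 nat) \<Rightarrow>\<^sub>0 'a::{zero,one}" where
  "mvar v = Poly_Mapping.single (Poly_Mapping.single v 1) 1"

definition mpderiv :: "'v \<Rightarrow> 'v cpoly \<Rightarrow> 'v cpoly" where
  "mpderiv v p = (\<Sum>m\<in>Poly_Mapping.keys p. Poly_Mapping.single (m - Poly_Mapping.single v 1)
                     (of_nat (Poly_Mapping.lookup m v) * Poly_Mapping.lookup p m))"

lemma poly_mapping_sum_single:
  "p = (\<Sum>m\<in>Poly_Mapping.keys p. Poly_Mapping.single m (Poly_Mapping.lookup p m))"
proof (rule poly_mapping_eqI)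
  fix k
  show "Poly_Mapping.lookup p k = Poly_Mapping.lookup
          (\<Sum>m\<in>Poly_Mapping.keys p. Poly_Mapping.single m (Poly_Mapping.lookup p m)) k"
    by (simp add: lookup_sum lookup_single when_def sum.delta in_keys_iff)
qed

lemma poly_mapping_single_induct [case_names zero single add]:
  fixes p :: "'a \<Rightarrow>\<^sub>0 'b::comm_monoid_add"
  assumes z: "P 0" and s: "\<And>m c. P (Poly_Mapping.single m c)"
    and a: "\<And>p q. P p \<Longrightarrow> P q \<Longrightarrow> P (p + q)"
  shows "P p"
proof -
  have "P (\<Sum>m\<in>A. Poly_Mapping.single m (Poly_Mapping.lookup p m))" if "finite A" for A
    using that by (induction A rule: finite_induct) (auto intro: z s a)
  then show ?thesis by (subst poly_mapping_sum_single) auto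
qed

lemma mpderiv_add: "mpderiv v (p + q) = mpderiv v p + mpderiv v q"
  unfolding mpderiv_def
  by (rule setsum_keys_plus_distrib) (auto simp: algebra_simps single_add)

lemma mpderiv_0 [simp]: "mpderiv v 0 = 0"
  by (simp add: mpderiv_def)

lemma mpderiv_single:
  "mpderiv v (Poly_Mapping.single m c)
     = Poly_Mapping.single (m - Poly_Mapping.single v 1) (of_nat (Poly_Mapping.lookup m v) * c)"
  by (cases "c = 0") (auto simp: mpderiv_def)

lemma exps_diff_add:
  fixes m k :: "'v \<Rightarrow>\<^sub>0 nat"
  assumes "Poly_Mapping.lookup m v \<noteq> 0"
  shows "m + k - Poly_Mapping.single v 1 = (m - Poly_Mapping.single v 1) + k"
  by (rule poly_mapping_eqI) (use assms in \<open>auto simp: lookup_add lookup_minus lookup_single when_def\<close>)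

lemma mpderiv_mult_single:
  "mpderiv v (Poly_Mapping.single m c * Poly_Mapping.single k d)
     = mpderiv v (Poly_Mapping.single m c) * Poly_Mapping.single k d
       + Poly_Mapping.single m c * mpderiv v (Poly_Mapping.single k d)"
proof -
  have 1: "Poly_Mapping.single (m + k - Poly_Mapping.single v 1) (of_nat (Poly_Mapping.lookup m v) * c * d)
    = Poly_Mapping.single ((m - Poly_Mapping.single v 1) + k) (of_nat (Poly_Mapping.lookup m v) * c * d)"
    by (cases "Poly_Mapping.lookup m v = 0") (auto simp: exps_diff_add[unfolded One_nat_def])
  have 2: "Poly_Mapping.single (m + k - Poly_Mapping.single v 1) (of_nat (Poly_Mapping.lookup k v) * c * d)
    = Poly_Mapping.single (m + (k - Poly_Mapping.single v 1)) (of_nat (Poly_Mapping.lookup k v) * c * d)"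
    by (cases "Poly_Mapping.lookup k v = 0")
       (auto simp: exps_diff_add[of k v m, unfolded One_nat_def] add.commute[of m])
  have "mpderiv v (Poly_Mapping.single m c * Poly_Mapping.single k d)
     = Poly_Mapping.single (m + k - Poly_Mapping.single v 1) (of_nat (Poly_Mapping.lookup m v) * c * d)
     + Poly_Mapping.single (m + k - Poly_Mapping.single v 1) (of_nat (Poly_Mapping.lookup k v) * c * d)"
    by (simp add: mpderiv_single mult_single lookup_add algebra_simps flip: single_add)
  then show ?thesis
    by (simp only: 1 2) (simp add: mpderiv_single mult_single algebra_simps)
qed

lemma mpderiv_mult: "mpderiv v (p * q) = mpderiv v p * q + p * mpderiv v q"
proof (induction p rule: poly_mapping_single_induct)
  case (single m c)
  show ?case
    by (induction q rule: poly_mapping_single_induct)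
       (simp_all add: mpderiv_mult_single mpderiv_add distrib_left algebra_simps)
qed (simp_all add: mpderiv_add algebra_simps)

lemma mpderiv_mvar: "mpderiv v (mvar w) = (if v = w then 1 else 0)"
  by (auto simp: mvar_def mpderiv_single lookup_single when_def)

lemma mpderiv_commute: "mpderiv v (mpderiv w p) = mpderiv w (mpderiv v p)"
proof (induction p rule: poly_mapping_single_induct)
  case (single m c)
  show ?case
  proof (cases "v = w")
    case False
    then show ?thesis
      by (simp add: mpderiv_single lookup_minus lookup_single diff_diff_eq add.commute mult.left_commute)
  qed auto
qed (simp_all add: mpderiv_add)

text \<open>The free monoid on a set of letters. With it, \<open>'g word \<Rightarrow>\<^sub>0 complex\<close> is the free
  associative algebra over the complex numbers on the letters \<open>'g\<close>.\<close>

datatype 'g word = Word (letters: "'g list")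

instantiation word :: (type) monoid_add
begin
definition zero_word :: "'g word" where "zero_word = Word []"
definition plus_word :: "'g word \<Rightarrow> 'g word \<Rightarrow> 'g word" where
  "plus_word v w = Word (letters v @ letters w)"
instance by standard (auto simp: zero_word_def plus_word_def)
end

lemma letters_0 [simp]: "letters 0 = []"
  by (simp add: zero_word_def)

text \<open>The letter \<open>Var v\<close> stands for the variable \<open>v\<close>, and \<open>Der v\<close> for \<open>\<partial>\<^sub>v\<close>.\<close>

datatype 'v weyl_gen = Var 'v | Der 'v

type_synonym 'v free_weyl = "'v weyl_gen word \<Rightarrow>\<^sub>0 complex"

definition letter :: "'g \<Rightarrow> 'g word \<Rightarrow>\<^sub>0 complex" where
  "letter a = Poly_Mapping.single (Word [a]) 1"

definition commutator :: "'a::ring \<Rightarrow> 'a \<Rightarrow> 'a" where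
  "commutator a b = a * b - b * a"

definition weyl_rels :: "'v free_weyl set" where
  "weyl_rels = {commutator (letter (Var v)) (letter (Var w)) | v w. True}
     \<union> {commutator (letter (Der v)) (letter (Der w)) | v w. True}
     \<union> {commutator (letter (Der v)) (letter (Var w)) - (if v = w then 1 else 0) | v w. True}"

text \<open>\<open>free_act scale op p\<close> is the action of \<open>p\<close> on a complex vector space on which the
  letter \<open>a\<close> acts as \<open>op a\<close>.\<close>

definition free_act ::
  "(complex \<Rightarrow> 'm \<Rightarrow> 'm) \<Rightarrow> ('g \<Rightarrow> 'm \<Rightarrow> 'm) \<Rightarrow> ('g word \<Rightarrow>\<^sub>0 complex) \<Rightarrow> 'm \<Rightarrow> 'm::comm_monoid_add"
where
  "free_act scale op p h =
     (\<Sum>w\<in>Poly_Mapping.keys p. scale (Poly_Mapping.lookup p w) (foldr op (letters w) h))"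

locale weyl_ops = module scale for scale :: "complex \<Rightarrow> 'm::ab_group_add \<Rightarrow> 'm" +
  fixes op :: "'v weyl_gen \<Rightarrow> 'm \<Rightarrow> 'm"
  assumes op_add: "op a (x + y) = op a x + op a y"
    and op_scale: "op a (scale c x) = scale c (op a x)"
    and op_Var_Var: "op (Var v) (op (Var w) x) = op (Var w) (op (Var v) x)"
    and op_Der_Der: "op (Der v) (op (Der w) x) = op (Der w) (op (Der v) x)"
    and op_Der_Var: "op (Der v) (op (Var w) x) = op (Var w) (op (Der v) x) + (if v = w then x else 0)"
begin

lemma foldr_op_add: "foldr op ws (x + y) = foldr op ws x + foldr op ws y"
  by (induction ws) (auto simp: op_add)

lemma foldr_op_scale: "foldr op ws (scale c x) = scale c (foldr op ws x)"
  by (induction ws) (auto simp: op_scale)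

lemma act_0 [simp]: "free_act scale op 0 x = 0"
  by (simp add: free_act_def)

lemma act_add: "free_act scale op (p + q) x = free_act scale op p x + free_act scale op q x"
  unfolding free_act_def
  by (rule setsum_keys_plus_distrib[where f="\<lambda>w c. scale c (foldr op (letters w) x)"])
     (auto simp: scale_left_distrib)

lemma act_single: "free_act scale op (Poly_Mapping.single w c) x = scale c (foldr op (letters w) x)"
  by (cases "c = 0") (auto simp: free_act_def)

lemma act_diff: "free_act scale op (p - q) x = free_act scale op p x - free_act scale op q x"
  using act_add[of "p - q" q x] by (simp add: algebra_simps)

lemma act_add_right: "free_act scale op p (x + y) = free_act scale op p x + free_act scale op p y"
  by (simp add: free_act_def foldr_op_add scale_right_distrib sum.distrib)

lemma act_0_right [simp]: "free_act scale op p 0 = 0"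
  using act_add_right[of p 0 0] by simp

lemma act_scale_right: "free_act scale op p (scale c x) = scale c (free_act scale op p x)"
  by (simp add: free_act_def foldr_op_scale scale_sum_right mult.commute)

lemma act_mult: "free_act scale op (p * q) x = free_act scale op p (free_act scale op q x)"
proof (induction p rule: poly_mapping_single_induct)
  case (single v c)
  show ?case
    by (induction q rule: poly_mapping_single_induct)
       (simp_all add: mult_single act_single plus_word_def distrib_left act_add act_add_right
         foldr_op_scale foldr_op_add scale_right_distrib)
qed (simp_all add: act_add distrib_right)

lemma act_one [simp]: "free_act scale op 1 x = x"
  using act_single[of 0 1 x] by simp

lemma act_letter: "free_act scale op (letter a) x = op a x"
  by (simp add: letter_def act_single)

lemma act_weyl_rels: "p \<in> weyl_rels \<Longrightarrow> free_act scale op p x = 0"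
  by (auto simp: weyl_rels_def commutator_def act_diff act_mult act_letter
      op_Var_Var op_Der_Der[of _ _ x] op_Der_Var)

lemma act_ideal:
  assumes "p \<in> two_sided_ideal hull weyl_rels" shows "free_act scale op p x = 0"
proof -
  have "two_sided_ideal {p. \<forall>x. free_act scale op p x = 0}"
    by (auto simp: two_sided_ideal_def left_ideal_def act_add act_mult)
  then have "two_sided_ideal hull weyl_rels \<subseteq> {p. \<forall>x. free_act scale op p x = 0}"
    by (intro hull_minimal) (auto simp: act_weyl_rels)
  with assms show ?thesis by auto
qed

end

lemma one_notin_weyl_ideal: "(1 :: 'v free_weyl) \<notin> two_sided_ideal hull weyl_rels"
proof
  assume 1: "(1 :: 'v free_weyl) \<in> two_sided_ideal hull weyl_rels"
  let ?scale = "\<lambda>c p. Poly_Mapping.single 0 c * (p :: 'v cpoly)"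
  let ?op = "\<lambda>a. case a of Var v \<Rightarrow> (\<lambda>p. mvar v * p) | Der v \<Rightarrow> mpderiv v"
  interpret weyl_ops ?scale ?op
    by unfold_locales
       (auto simp: algebra_simps single_add mult_single mpderiv_add mpderiv_mult mpderiv_single
             mpderiv_mvar mpderiv_commute split: weyl_gen.splits)
  show False using act_ideal[OF 1, of 1] by simp
qed

definition weyl_eq :: "'v free_weyl \<Rightarrow> 'v free_weyl \<Rightarrow> bool" where
  "weyl_eq p q \<longleftrightarrow> p - q \<in> two_sided_ideal hull weyl_rels"

lemma weyl_eq_equivp: "equivp (weyl_eq :: 'v free_weyl \<Rightarrow> _)"
proof (rule equivpI)
  let ?J = "two_sided_ideal hull (weyl_rels :: 'v free_weyl set)"
  have J: "left_ideal ?J" using two_sided_ideal_hull two_sided_ideal_def by blast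
  then have 0: "0 \<in> ?J" by (simp add: left_ideal_def)
  show "reflp (weyl_eq :: 'v free_weyl \<Rightarrow> _)" using 0 by (auto simp: reflp_def weyl_eq_def)
  show "symp (weyl_eq :: 'v free_weyl \<Rightarrow> _)" using left_ideal_diff[OF J 0] by (fastforce simp: symp_def weyl_eq_def)
  have "p - r \<in> ?J" if "p - q \<in> ?J" "q - r \<in> ?J" for p q r
  proof -
    have "(p - q) + (q - r) \<in> ?J" using J that unfolding left_ideal_def by blast
    then show ?thesis by simp
  qed
  then show "transp (weyl_eq :: 'v free_weyl \<Rightarrow> _)" by (auto simp: transp_def weyl_eq_def)
qed

text \<open>The Weyl algebra in the variables \<open>'v\<close>, by generators and relations.\<close>

quotient_type 'v weyl = "'v free_weyl" / weyl_eq
  by (rule weyl_eq_equivp)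

instantiation weyl :: (type) ring_1
begin

lift_definition zero_weyl :: "'a weyl" is 0 .
lift_definition one_weyl :: "'a weyl" is 1 .

lift_definition plus_weyl :: "'a weyl \<Rightarrow> 'a weyl \<Rightarrow> 'a weyl" is "\<lambda>p q. p + q"
proof -
  fix p p' q q' :: "'a free_weyl"
  let ?J = "two_sided_ideal hull (weyl_rels :: 'a free_weyl set)"
  have J: "left_ideal ?J" using two_sided_ideal_hull two_sided_ideal_def by blast
  assume "weyl_eq p p'" "weyl_eq q q'"
  then have "(p - p') + (q - q') \<in> ?J" using J unfolding left_ideal_def weyl_eq_def by blast
  then show "weyl_eq (p + q) (p' + q')" by (simp add: weyl_eq_def algebra_simps)
qed

lift_definition uminus_weyl :: "'a weyl \<Rightarrow> 'a weyl" is "\<lambda>p. - p"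
proof -
  fix p p' :: "'a free_weyl"
  let ?J = "two_sided_ideal hull (weyl_rels :: 'a free_weyl set)"
  have J: "left_ideal ?J" using two_sided_ideal_hull two_sided_ideal_def by blast
  assume "weyl_eq p p'"
  then have "(-1) * (p - p') \<in> ?J" using J unfolding left_ideal_def weyl_eq_def by blast
  then show "weyl_eq (- p) (- p')" by (simp add: weyl_eq_def)
qed

definition minus_weyl :: "'a weyl \<Rightarrow> 'a weyl \<Rightarrow> 'a weyl" where
  "minus_weyl P Q = P + (- Q)"

lift_definition times_weyl :: "'a weyl \<Rightarrow> 'a weyl \<Rightarrow> 'a weyl" is "\<lambda>p q. p * q"
proof -
  fix p p' q q' :: "'a free_weyl"
  let ?J = "two_sided_ideal hull (weyl_rels :: 'a free_weyl set)"
  have T: "two_sided_ideal ?J" by (rule two_sided_ideal_hull)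
  assume "weyl_eq p p'" "weyl_eq q q'"
  then have "(p - p') * q \<in> ?J" "p' * (q - q') \<in> ?J"
    using T unfolding two_sided_ideal_def left_ideal_def weyl_eq_def by blast+
  then have "(p - p') * q + p' * (q - q') \<in> ?J"
    using T unfolding two_sided_ideal_def left_ideal_def by blast
  then show "weyl_eq (p * q) (p' * q')" by (simp add: weyl_eq_def algebra_simps)
qed

instance
proof
  show "(0 :: 'a weyl) \<noteq> 1"
  proof (transfer, unfold weyl_eq_def, rule)
    let ?J = "two_sided_ideal hull (weyl_rels :: 'a free_weyl set)"
    assume "0 - 1 \<in> ?J"
    moreover have "two_sided_ideal ?J" by (rule two_sided_ideal_hull)
    ultimately have "(-1) * (0 - 1) \<in> ?J" unfolding two_sided_ideal_def left_ideal_def by blast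
    then show False using one_notin_weyl_ideal[where 'v='a] by simp
  qed
qed (unfold minus_weyl_def,
     (transfer, simp add: algebra_simps equivp_reflp[OF weyl_eq_equivp])+)

end

lift_definition weyl_const :: "complex \<Rightarrow> 'v weyl" is "\<lambda>c. Poly_Mapping.single 0 c" .
lift_definition weyl_var :: "'v \<Rightarrow> 'v weyl" is "\<lambda>v. letter (Var v)" .
lift_definition weyl_der :: "'v \<Rightarrow> 'v weyl" is "\<lambda>v. letter (Der v)" .


lemma abs_weyl_eqI:
  "p - q \<in> weyl_rels \<Longrightarrow> abs_weyl p = abs_weyl q"
  by (auto simp: weyl.abs_eq_iff weyl_eq_def intro: hull_inc)

lemma weyl_var_commute: "weyl_var v * weyl_var w = weyl_var w * weyl_var v"
  unfolding weyl_var.abs_eq times_weyl.abs_eq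
  by (rule abs_weyl_eqI) (auto simp: weyl_rels_def commutator_def)

lemma weyl_der_commute: "weyl_der v * weyl_der w = weyl_der w * weyl_der v"
  unfolding weyl_der.abs_eq times_weyl.abs_eq
  by (rule abs_weyl_eqI) (auto simp: weyl_rels_def commutator_def)

lemma weyl_der_var:
  "weyl_der v * weyl_var w = weyl_var w * weyl_der v + (if v = w then 1 else 0)"
proof -
  have "letter (Der v) * letter (Var w) - (letter (Var w) * letter (Der v) + (if v = w then 1 else 0))
      \<in> (weyl_rels :: 'a free_weyl set)"
    by (auto simp: weyl_rels_def commutator_def algebra_simps)
  from abs_weyl_eqI[OF this] show ?thesis
    unfolding weyl_der.abs_eq weyl_var.abs_eq times_weyl.abs_eq
    by (auto simp: plus_weyl.abs_eq[symmetric] one_weyl.abs_eq[symmetric] zero_weyl.abs_eq[symmetric]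
          split: if_splits)
qed

text \<open>By the quotient rule; the choice of representative is irrelevant by \<open>fract_deriv_Fract\<close> below.\<close>

definition fract_deriv :: "'n::linorder \<Rightarrow> 'n cpoly fract \<Rightarrow> 'n cpoly fract" where
  "fract_deriv j q = (case rep_fract q of (a, b) \<Rightarrow>
     Fract (mpderiv j a * b - a * mpderiv j b) (b * b))"

lemma rep_fract_cases:
  obtains a b where "rep_fract q = (a, b)" "b \<noteq> 0" "q = Fract a b"
proof (cases "rep_fract q")
  case (Pair a b)
  have r: "fractrel (rep_fract q) (rep_fract q)" "abs_fract (rep_fract q) = q"
    using Quotient3_rep_reflp[OF Quotient3_fract] Quotient3_abs_rep[OF Quotient3_fract] by blast+
  with Pair have "b \<noteq> 0" by simp
  moreover have "q = Fract a b" using r Pair \<open>b \<noteq> 0\<close> by (simp add: Fract.abs_eq)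
  ultimately show thesis using Pair that by blast
qed

lemma fract_deriv_Fract:
  assumes "b \<noteq> 0"
  shows "fract_deriv j (Fract a b) = Fract (mpderiv j a * b - a * mpderiv j b) (b * b)"
proof -
  obtain c d where r: "rep_fract (Fract a b) = (c, d)" and d: "d \<noteq> 0" and q: "Fract a b = Fract c d"
    by (rule rep_fract_cases)
  have e: "a * d = c * b" using q assms d by (simp add: eq_fract)
  then have "mpderiv j (a * d) = mpderiv j (c * b)" by simp
  then have "mpderiv j a * d + a * mpderiv j d = mpderiv j c * b + c * mpderiv j b"
    by (simp add: mpderiv_mult)
  then have "(mpderiv j a * b - a * mpderiv j b) * (d * d) = (mpderiv j c * d - c * mpderiv j d) * (b * b)"
    using e by algebra
  then show ?thesis using assms d by (simp add: fract_deriv_def r eq_fract)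
qed

lemma fract_deriv_add: "fract_deriv j (p + q) = fract_deriv j p + fract_deriv j q"
  by (cases p; cases q) (auto simp: fract_deriv_Fract eq_fract mpderiv_add mpderiv_mult algebra_simps)

lemma fract_deriv_mult: "fract_deriv j (p * q) = fract_deriv j p * q + p * fract_deriv j q"
  by (cases p; cases q) (auto simp: fract_deriv_Fract eq_fract mpderiv_add mpderiv_mult algebra_simps)

lemma mpderiv_1 [simp]: "mpderiv j 1 = 0"
  using mpderiv_mult[of j 1 1] by simp

lemma fract_deriv_to_fract [simp]: "fract_deriv j (to_fract p) = to_fract (mpderiv j p)"
  by (simp add: to_fract_def fract_deriv_Fract)

lemma fract_deriv_0 [simp]: "fract_deriv j 0 = 0"
  using fract_deriv_to_fract[of j 0] by simp

lemma fract_deriv_1 [simp]: "fract_deriv j 1 = 0"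
  using fract_deriv_to_fract[of j 1] by simp

lemma fract_deriv_minus: "fract_deriv j (- p) = - fract_deriv j p"
  using fract_deriv_add[of j p "- p"] by (simp add: eq_neg_iff_add_eq_0 add.commute)

lemma fract_deriv_commute: "fract_deriv i (fract_deriv j q) = fract_deriv j (fract_deriv i q)"
proof -
  define E where "E q = fract_deriv i (fract_deriv j q) - fract_deriv j (fract_deriv i q)" for q
  have Em: "E (p * q) = E p * q + p * E q" for p q
    by (simp add: E_def fract_deriv_mult fract_deriv_add algebra_simps)
  have E0: "E (to_fract p) = 0" for p by (simp add: E_def mpderiv_commute)
  obtain a b where q: "q = Fract a b" "b \<noteq> 0" by (cases q)
  then have "q * to_fract b = to_fract a" by (simp add: to_fract_def eq_fract)
  then have "E q * to_fract b = 0" using Em[of q "to_fract b"] E0 by simp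
  moreover have "to_fract b \<noteq> 0" using q by (simp add: to_fract_def Zero_fract_def eq_fract)
  ultimately have "E q = 0" by simp
  then show ?thesis by (simp add: E_def)
qed

text \<open>Substituting \<open>s\<^sub>j + c\<close> for \<open>s\<^sub>j\<close> in a polynomial in the variables \<open>s\<^sub>k\<close>.\<close>

definition s_shift :: "'r::finite \<Rightarrow> 'k::comm_ring_1 \<Rightarrow> (('r \<Rightarrow>\<^sub>0 nat) \<Rightarrow>\<^sub>0 'k) \<Rightarrow> (('r \<Rightarrow>\<^sub>0 nat) \<Rightarrow>\<^sub>0 'k)" where
  "s_shift j c h = (\<Sum>m\<in>Poly_Mapping.keys h. Poly_Mapping.single 0 (Poly_Mapping.lookup h m) *
     (\<Prod>k\<in>UNIV. (mvar k + (if k = j then Poly_Mapping.single 0 c else 0)) ^ Poly_Mapping.lookup m k))"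

text \<open>The element \<open>h \<Prod>\<^sub>i f\<^sub>i^s\<^sub>i\<close> is represented by \<open>h\<close>. Coefficients are allowed to be arbitrary
  rational functions; \<open>nf_carrier f\<close> is \<open>N\<^sub>f\<close>, in which only powers of \<open>\<Prod>\<^sub>i f\<^sub>i\<close> occur as
  denominators. By \<open>nf_act_carrier\<close> below it is a submodule, so an equation between elements
  of \<open>N\<^sub>f\<close> has the same meaning in the larger module.\<close>

type_synonym ('n, 'r) nf = "('r \<Rightarrow>\<^sub>0 nat) \<Rightarrow>\<^sub>0 'n cpoly fract"

definition nf_carrier :: "('r::finite \<Rightarrow> 'n::linorder cpoly) \<Rightarrow> ('n, 'r) nf set" where
  "nf_carrier f = {h. \<forall>m. \<exists>a k. Poly_Mapping.lookup h m = Fract a ((\<Prod>i\<in>UNIV. f i) ^ k)}"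

definition nf_coeff :: "'n::linorder cpoly fract \<Rightarrow> ('n, 'r) nf" where
  "nf_coeff q = Poly_Mapping.single 0 q"

definition nf_log_deriv :: "('r::finite \<Rightarrow> 'n::linorder cpoly) \<Rightarrow> 'n \<Rightarrow> ('n, 'r) nf" where
  "nf_log_deriv f j = (\<Sum>k\<in>UNIV. mvar k * nf_coeff (Fract (mpderiv j (f k)) (f k)))"

text \<open>The variable \<open>Inl j\<close> is \<open>x\<^sub>j\<close>, and \<open>Inr j\<close> is \<open>t\<^sub>j\<close>.\<close>

fun nf_op :: "('r::finite \<Rightarrow> 'n::linorder cpoly) \<Rightarrow> ('n + 'r) weyl_gen \<Rightarrow> ('n, 'r) nf \<Rightarrow> ('n, 'r) nf" where
  "nf_op f (Var (Inl j)) h = nf_coeff (to_fract (mvar j)) * h"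
| "nf_op f (Der (Inl j)) h = Poly_Mapping.map (fract_deriv j) h + h * nf_log_deriv f j"
| "nf_op f (Var (Inr j)) h = s_shift j 1 h * nf_coeff (to_fract (f j))"
| "nf_op f (Der (Inr j)) h = - mvar j * s_shift j (- 1) h * nf_coeff (Fract 1 (f j))"

definition nf_scale :: "complex \<Rightarrow> ('n::linorder, 'r) nf \<Rightarrow> ('n, 'r) nf" where
  "nf_scale c h = nf_coeff (to_fract (Poly_Mapping.single 0 c)) * h"

text \<open>The action does not depend on the representative if the \<open>f i\<close> are nonzero;
  see \<open>nf_act_abs\<close> below.\<close>

definition nf_act :: "('r::finite \<Rightarrow> 'n::linorder cpoly) \<Rightarrow> ('n + 'r) weyl \<Rightarrow> ('n, 'r) nf \<Rightarrow> ('n, 'r) nf" where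
  "nf_act f P = free_act nf_scale (nf_op f) (rep_weyl P)"

lemma s_shift_add: "s_shift j c (p + q) = s_shift j c p + s_shift j c q"
  unfolding s_shift_def
  by (rule setsum_keys_plus_distrib) (auto simp: algebra_simps single_add)

lemma s_shift_single: "s_shift j c (Poly_Mapping.single m a) = Poly_Mapping.single 0 a *
     (\<Prod>k\<in>UNIV. (mvar k + (if k = j then Poly_Mapping.single 0 c else 0)) ^ Poly_Mapping.lookup m k)"
  by (cases "a = 0") (auto simp: s_shift_def)

lemma s_shift_0 [simp]: "s_shift j c 0 = 0"
  by (simp add: s_shift_def)

lemma s_shift_mult:
  fixes p q :: "('r::finite \<Rightarrow>\<^sub>0 nat) \<Rightarrow>\<^sub>0 'k::comm_ring_1"
  shows "s_shift j c (p * q) = s_shift j c p * s_shift j c q"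
proof (induction p rule: poly_mapping_single_induct)
  case (single m a)
  show ?case
  proof (induction q rule: poly_mapping_single_induct)
    case (single k b)
    have eq: "Poly_Mapping.single 0 (a * b) = Poly_Mapping.single 0 a * Poly_Mapping.single (0 :: 'r \<Rightarrow>\<^sub>0 nat) b"
      by (simp add: mult_single)
    then show ?case
      by (simp only: mult_single[of m a k b] s_shift_single lookup_add power_add prod.distrib eq)
         (simp only: ac_simps)
  qed (simp_all add: s_shift_add distrib_left)
qed (simp_all add: s_shift_add distrib_right)

lemma s_shift_const: "s_shift j c (Poly_Mapping.single 0 a) = Poly_Mapping.single 0 a"
  by (simp add: s_shift_single)

lemma s_shift_mvar:
  "s_shift j c (mvar k) = mvar k + (if k = j then Poly_Mapping.single 0 c else 0)"
proof -
  have "(\<Prod>i\<in>UNIV. (mvar i + (if i = j then Poly_Mapping.single 0 c else 0)) ^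
           Poly_Mapping.lookup (Poly_Mapping.single k (1::nat)) i)
      = (\<Prod>i\<in>UNIV. if i = k then mvar k + (if k = j then Poly_Mapping.single 0 c else 0) else 1)"
    by (rule prod.cong) (auto simp: lookup_single when_def)
  then show ?thesis
    by (subst mvar_def) (simp add: s_shift_single prod.delta)
qed

lemma mvar_power: "(mvar k :: ('r \<Rightarrow>\<^sub>0 nat) \<Rightarrow>\<^sub>0 'k::comm_ring_1) ^ n
    = Poly_Mapping.single (Poly_Mapping.single k n) 1"
  by (induction n) (auto simp: mvar_def mult_single simp flip: single_add)

lemma single_prod_mvar:
  fixes m :: "'r::finite \<Rightarrow>\<^sub>0 nat" and a :: "'k::comm_ring_1"
  shows "Poly_Mapping.single m a
    = Poly_Mapping.single 0 a * (\<Prod>k\<in>UNIV. mvar k ^ Poly_Mapping.lookup m k)"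
proof -
  have 1: "(\<Prod>k\<in>A. (mvar k :: ('r \<Rightarrow>\<^sub>0 nat) \<Rightarrow>\<^sub>0 'k) ^ Poly_Mapping.lookup m k)
     = Poly_Mapping.single (\<Sum>k\<in>A. Poly_Mapping.single k (Poly_Mapping.lookup m k)) 1" for A
    by (induction A rule: infinite_finite_induct) (auto simp: mvar_power mult_single)
  have 2: "(\<Sum>k\<in>UNIV. Poly_Mapping.single k (Poly_Mapping.lookup m k)) = m"
    by (rule poly_mapping_eqI) (simp add: lookup_sum lookup_single when_def sum.delta)
  show ?thesis by (simp add: 1 2 mult_single)
qed

lemma mult_induct_single [case_names zero const mvar add mult]:
  fixes p :: "('r::finite \<Rightarrow>\<^sub>0 nat) \<Rightarrow>\<^sub>0 'k::comm_ring_1"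
  assumes "P 0" and c: "\<And>a. P (Poly_Mapping.single 0 a)" and v: "\<And>k. P (mvar k)"
    and a: "\<And>p q. P p \<Longrightarrow> P q \<Longrightarrow> P (p + q)" and m: "\<And>p q. P p \<Longrightarrow> P q \<Longrightarrow> P (p * q)"
  shows "P p"
proof (induction p rule: poly_mapping_single_induct)
  case (single m b)
  have one: "P 1" using c[of 1] by simp
  have pow: "P (mvar k ^ n)" for k n by (induction n) (auto intro: one v m)
  have "P (\<Prod>k\<in>A. mvar k ^ Poly_Mapping.lookup m k)" for A
    by (induction A rule: infinite_finite_induct) (auto intro: one m pow)
  then show ?case by (subst single_prod_mvar) (intro m c)
qed (auto intro: assms)

lemma s_shift_commute: "s_shift i c (s_shift j d p) = s_shift j d (s_shift i c p)"
  by (induction p rule: mult_induct_single)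
     (auto simp: s_shift_add s_shift_mult s_shift_const s_shift_mvar)

lemma s_shift_inverse: "s_shift i c (s_shift i (- c) p) = p" "s_shift i (- c) (s_shift i c p) = p"
  by (induction p rule: mult_induct_single)
     (auto simp: s_shift_add s_shift_mult s_shift_const s_shift_mvar simp flip: single_add)

lemma map_deriv_lookup:
  "Poly_Mapping.lookup (Poly_Mapping.map (fract_deriv j) h) m = fract_deriv j (Poly_Mapping.lookup h m)"
  by (simp add: map.rep_eq when_def)

lemma map_deriv_add: "Poly_Mapping.map (fract_deriv j) (p + q)
    = Poly_Mapping.map (fract_deriv j) p + Poly_Mapping.map (fract_deriv j) q"
  by (rule poly_mapping_eqI) (simp add: map_deriv_lookup lookup_add fract_deriv_add)

lemma map_deriv_single: "Poly_Mapping.map (fract_deriv j) (Poly_Mapping.single m a)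
    = Poly_Mapping.single m (fract_deriv j a)"
  by (rule poly_mapping_eqI) (simp add: map_deriv_lookup lookup_single when_def)

lemma map_deriv_0 [simp]: "Poly_Mapping.map (fract_deriv j) 0 = 0"
  by (rule poly_mapping_eqI) (simp add: map_deriv_lookup)

lemma map_deriv_mult:
  fixes p q :: "('n::linorder, 'r) nf"
  shows "Poly_Mapping.map (fract_deriv j) (p * q)
    = Poly_Mapping.map (fract_deriv j) p * q + p * Poly_Mapping.map (fract_deriv j) q"
proof (induction p rule: poly_mapping_single_induct)
  case (single m a)
  show ?case
    by (induction q rule: poly_mapping_single_induct)
       (simp_all add: mult_single map_deriv_single map_deriv_add fract_deriv_mult single_add algebra_simps)
qed (simp_all add: map_deriv_add algebra_simps)

lemma map_deriv_commute: "Poly_Mapping.map (fract_deriv i) (Poly_Mapping.map (fract_deriv j) p)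
    = Poly_Mapping.map (fract_deriv j) (Poly_Mapping.map (fract_deriv i) p)"
  by (rule poly_mapping_eqI) (simp add: map_deriv_lookup fract_deriv_commute)

lemma map_deriv_mvar [simp]: "Poly_Mapping.map (fract_deriv i) (mvar k) = 0"
  by (simp add: mvar_def map_deriv_single)

lemma map_deriv_shift:
  assumes "fract_deriv i c = 0"
  shows "Poly_Mapping.map (fract_deriv i) (s_shift j c p) = s_shift j c (Poly_Mapping.map (fract_deriv i) p)"
  by (induction p rule: mult_induct_single)
     (auto simp: s_shift_add s_shift_mult s_shift_const s_shift_mvar map_deriv_add map_deriv_mult
        map_deriv_single assms)

lemma map_deriv_coeff: "Poly_Mapping.map (fract_deriv j) (nf_coeff q) = nf_coeff (fract_deriv j q)"
  by (simp add: nf_coeff_def map_deriv_single)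

lemma s_shift_coeff: "s_shift j c (nf_coeff q) = nf_coeff q"
  by (simp add: nf_coeff_def s_shift_const)

lemma nf_coeff_simps:
  "nf_coeff p * nf_coeff q = nf_coeff (p * q)" "nf_coeff p + nf_coeff q = nf_coeff (p + q)"
  "- nf_coeff p = nf_coeff (- p)" "nf_coeff 1 = 1" "nf_coeff 0 = 0"
  by (simp_all add: nf_coeff_def mult_single single_add single_uminus)

lemma fract_deriv_log:
  assumes "a \<noteq> 0"
  shows "fract_deriv i (Fract (mpderiv j a) a) = fract_deriv j (Fract (mpderiv i a) a)"
  using assms by (simp add: fract_deriv_Fract mpderiv_commute[of i j] mult.commute)

lemma s_shift_sum: "s_shift i c (sum h A) = (\<Sum>k\<in>A. s_shift i c (h k))"
  by (induction A rule: infinite_finite_induct) (auto simp: s_shift_add)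

lemma map_deriv_sum: "Poly_Mapping.map (fract_deriv i) (sum h A)
    = (\<Sum>k\<in>A. Poly_Mapping.map (fract_deriv i) (h k))"
  by (induction A rule: infinite_finite_induct) (auto simp: map_deriv_add)

lemma s_shift_log_deriv:
  "s_shift i c (nf_log_deriv f j) = nf_log_deriv f j + nf_coeff (c * Fract (mpderiv j (f i)) (f i))"
proof -
  have "s_shift i c (nf_log_deriv f j)
     = (\<Sum>k\<in>UNIV. mvar k * nf_coeff (Fract (mpderiv j (f k)) (f k))
          + (if k = i then nf_coeff (c * Fract (mpderiv j (f i)) (f i)) else 0))"
    unfolding nf_log_deriv_def s_shift_sum
    by (rule sum.cong) (auto simp: s_shift_mult s_shift_coeff s_shift_mvar distrib_right
        nf_coeff_simps simp flip: nf_coeff_def)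
  then show ?thesis by (simp add: sum.distrib nf_log_deriv_def)
qed

lemma map_deriv_log_deriv:
  assumes "\<And>k. f k \<noteq> 0"
  shows "Poly_Mapping.map (fract_deriv i) (nf_log_deriv f j)
       = Poly_Mapping.map (fract_deriv j) (nf_log_deriv f i)"
  unfolding nf_log_deriv_def map_deriv_sum
  by (rule sum.cong) (auto simp: map_deriv_mult map_deriv_coeff fract_deriv_log[OF assms, of i j])

lemma weyl_ops_nf:
  fixes f :: "'r::finite \<Rightarrow> 'n::linorder cpoly"
  assumes f: "\<And>k. f k \<noteq> 0"
  shows "weyl_ops nf_scale (nf_op f)"
proof -
  let ?D = "\<lambda>j. Poly_Mapping.map (fract_deriv j)"
  let ?l = "\<lambda>j i. nf_coeff (Fract (mpderiv j (f i)) (f i)) :: ('n, 'r) nf"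
  let ?F = "\<lambda>i. nf_coeff (to_fract (f i)) :: ('n, 'r) nf"
  let ?G = "\<lambda>i. nf_coeff (Fract 1 (f i)) :: ('n, 'r) nf"
  note D = map_deriv_add map_deriv_mult map_deriv_coeff map_deriv_shift
  note S = s_shift_add s_shift_mult s_shift_coeff s_shift_log_deriv
  have Mneg: "(nf_coeff (Fract (- a) b) :: ('n, 'r) nf) = - nf_coeff (Fract a b)" for a b
    by (simp add: nf_coeff_simps)
  have m1: "fract_deriv j (- 1) = 0" for j :: 'n by (simp add: fract_deriv_minus)
  have FG: "?F i * ?G i = 1" for i
  proof -
    have "Fract (f i) (f i) = 1" using f[of i] by (simp add: One_fract_def eq_fract)
    then show ?thesis by (simp add: nf_coeff_simps to_fract_def)
  qed
  have DF: "?D j (?F i) = ?F i * ?l j i" for i j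
  proof -
    have "to_fract (mpderiv j (f i)) = to_fract (f i) * Fract (mpderiv j (f i)) (f i)"
      using f[of i] by (simp add: to_fract_def eq_fract)
    then show ?thesis by (simp add: map_deriv_coeff nf_coeff_simps)
  qed
  have DG: "?D j (?G i) = - ?G i * ?l j i" for i j
    using f[of i] by (simp add: map_deriv_coeff fract_deriv_Fract nf_coeff_simps)
  have scD: "mpderiv j (Poly_Mapping.single 0 c) = 0" for c and j :: 'n
    by (simp add: mpderiv_single)
  have Dneg: "?D j (- p) = - ?D j p" for j and p :: "('n, 'r) nf"
    using map_deriv_add[of j p "- p"] by (simp add: eq_neg_iff_add_eq_0 add.commute)
  have Sneg: "s_shift i c (- p) = - s_shift i c p" for i c and p :: "('n, 'r) nf"
    using s_shift_add[of i c p "- p"] by (simp add: eq_neg_iff_add_eq_0 add.commute)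
  show ?thesis
  proof
    fix a b :: complex and x y :: "('n, 'r) nf"
    show "nf_scale a (x + y) = nf_scale a x + nf_scale a y"
      by (simp add: nf_scale_def distrib_left)
    show "nf_scale (a + b) x = nf_scale a x + nf_scale b x"
      by (simp add: nf_scale_def single_add distrib_right flip: nf_coeff_simps)
    show "nf_scale a (nf_scale b x) = nf_scale (a * b) x"
      by (simp add: nf_scale_def nf_coeff_simps mult_single flip: mult.assoc to_fract_mult)
    show "nf_scale 1 x = x"
      by (simp add: nf_scale_def nf_coeff_simps)
  next
    fix a :: "('n + 'r) weyl_gen" and c and x y :: "('n, 'r) nf"
    show "nf_op f a (x + y) = nf_op f a x + nf_op f a y"
      by (induction f a x rule: nf_op.induct) (auto simp: map_deriv_add s_shift_add algebra_simps)
    show "nf_op f a (nf_scale c x) = nf_scale c (nf_op f a x)"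
      by (induction f a x rule: nf_op.induct) (auto simp: nf_scale_def D S scD nf_coeff_simps algebra_simps)
  next
    fix v w and x :: "('n, 'r) nf"
    show "nf_op f (Var v) (nf_op f (Var w) x) = nf_op f (Var w) (nf_op f (Var v) x)"
      by (cases v; cases w) (auto simp: S s_shift_commute algebra_simps)
    show "nf_op f (Der v) (nf_op f (Der w) x) = nf_op f (Der w) (nf_op f (Der v) x)"
    proof (cases v)
      case v: (Inl j)
      show ?thesis
      proof (cases w)
        case (Inl i)
        then show ?thesis
          by (simp add: v D map_deriv_commute[of i j] map_deriv_log_deriv[where f=f and i=i and j=j, OF f] algebra_simps)
      next
        case (Inr i)
        then show ?thesis
          by (simp add: v D S Dneg DG[unfolded map_deriv_coeff] m1 Mneg algebra_simps)
      qed
    next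
      case v: (Inr j)
      show ?thesis
      proof (cases w)
        case (Inl i)
        then show ?thesis
          by (simp add: v D S Dneg DG[unfolded map_deriv_coeff] m1 Mneg algebra_simps)
      next
        case (Inr i)
        then show ?thesis
          by (cases "i = j") (simp_all add: v S Sneg s_shift_mvar s_shift_commute algebra_simps)
      qed
    qed
    show "nf_op f (Der v) (nf_op f (Var w) x) = nf_op f (Var w) (nf_op f (Der v) x) + (if v = w then x else 0)"
    proof (cases v)
      case v: (Inl j)
      show ?thesis
      proof (cases w)
        case (Inl i)
        then show ?thesis
          by (simp add: v D mpderiv_mvar nf_coeff_simps algebra_simps)
      next
        case (Inr i)
        then show ?thesis
          by (simp add: v map_deriv_add map_deriv_mult map_deriv_shift S DF m1 algebra_simps)
      qed
    next
      case v: (Inr j)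
      show ?thesis
      proof (cases w)
        case (Inl i)
        then show ?thesis by (simp add: v S algebra_simps)
      next
        case (Inr i)
        have "- mvar j * x * ?F j * ?G j = - mvar j * x" 
             "- (mvar j + 1) * x * ?G j * ?F j = - (mvar j + 1) * x"
          using FG[of j] by (simp_all add: mult.assoc mult.commute[of "?G j"])
        with Inr show ?thesis
          by (cases "i = j") 
             (auto simp: v S Sneg s_shift_mvar s_shift_commute s_shift_inverse
               s_shift_inverse[of _ 1, simplified] algebra_simps)
      qed
    qed
  qed
qed


theorem nf_act_abs:
  assumes "\<And>k. f k \<noteq> 0"
  shows "nf_act f (abs_weyl p) = free_act nf_scale (nf_op f) p"
proof
  fix h
  interpret weyl_ops nf_scale "nf_op f" by (rule weyl_ops_nf[OF assms])
  have "weyl_eq (rep_weyl (abs_weyl p)) p"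
    using Quotient3_rep_abs[OF Quotient3_weyl] equivp_reflp[OF weyl_eq_equivp] by blast
  then show "nf_act f (abs_weyl p) h = free_act nf_scale (nf_op f) p h"
    using act_ideal[of "rep_weyl (abs_weyl p) - p" h] by (simp add: nf_act_def weyl_eq_def act_diff)
qed

context
  fixes f :: "'r::finite \<Rightarrow> 'n::linorder cpoly"
  assumes f: "\<And>k. f k \<noteq> 0"
begin

interpretation weyl_ops nf_scale "nf_op f" by (rule weyl_ops_nf[OF f])

lemma nf_act_mult: "nf_act f (P * Q) h = nf_act f P (nf_act f Q h)"
  by (induction P rule: weyl.abs_induct, induction Q rule: weyl.abs_induct) (simp add: times_weyl.abs_eq nf_act_abs[OF f] act_mult)

lemma nf_act_add: "nf_act f (P + Q) h = nf_act f P h + nf_act f Q h"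
  by (induction P rule: weyl.abs_induct, induction Q rule: weyl.abs_induct) (simp add: plus_weyl.abs_eq nf_act_abs[OF f] act_add)

lemma nf_act_add_right: "nf_act f P (h + h') = nf_act f P h + nf_act f P h'"
  by (induction P rule: weyl.abs_induct) (simp add: nf_act_abs[OF f] act_add_right)

lemma nf_act_one: "nf_act f 1 h = h"
  by (simp add: one_weyl.abs_eq nf_act_abs[OF f])

lemma nf_act_const: "nf_act f (weyl_const c) h = nf_scale c h"
  by (simp add: weyl_const.abs_eq nf_act_abs[OF f] act_single)

lemma nf_act_var: "nf_act f (weyl_var v) h = nf_op f (Var v) h"
  by (simp add: weyl_var.abs_eq nf_act_abs[OF f] act_letter)

lemma nf_act_der: "nf_act f (weyl_der v) h = nf_op f (Der v) h"
  by (simp add: weyl_der.abs_eq nf_act_abs[OF f] act_letter)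

end

definition loc_ring :: "'n::linorder cpoly \<Rightarrow> 'n cpoly fract set" where
  "loc_ring p = {Fract a (p ^ k) | a k. True}"

lemma to_fract_in_loc_ring: "to_fract a \<in> loc_ring p"
  by (force simp: loc_ring_def to_fract_def intro: exI[of _ "0::nat"])

lemma loc_ring_add:
  assumes "p \<noteq> 0" "x \<in> loc_ring p" "y \<in> loc_ring p" shows "x + y \<in> loc_ring p"
proof -
  from assms obtain a k b l where "x = Fract a (p ^ k)" "y = Fract b (p ^ l)"
    by (auto simp: loc_ring_def)
  then have "x + y = Fract (a * p ^ l + b * p ^ k) (p ^ (k + l))"
    using assms by (simp add: power_add)
  then show ?thesis by (auto simp: loc_ring_def)
qed

lemma loc_ring_mult:
  assumes "x \<in> loc_ring p" "y \<in> loc_ring p" shows "x * y \<in> loc_ring p"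
proof -
  from assms obtain a k b l where "x = Fract a (p ^ k)" "y = Fract b (p ^ l)"
    by (auto simp: loc_ring_def)
  then have "x * y = Fract (a * b) (p ^ (k + l))" by (simp add: power_add)
  then show ?thesis by (auto simp: loc_ring_def)
qed

lemma loc_ring_deriv:
  assumes "p \<noteq> 0" "x \<in> loc_ring p" shows "fract_deriv j x \<in> loc_ring p"
proof -
  from assms obtain a k where "x = Fract a (p ^ k)" by (auto simp: loc_ring_def)
  then have "fract_deriv j x = Fract (mpderiv j a * p ^ k - a * mpderiv j (p ^ k)) (p ^ (k + k))"
    using assms by (simp add: fract_deriv_Fract power_add)
  then show ?thesis by (auto simp: loc_ring_def)
qed

lemma nf_carrier_iff:
  "h \<in> nf_carrier f \<longleftrightarrow> (\<forall>m. Poly_Mapping.lookup h m \<in> loc_ring (\<Prod>i\<in>UNIV. f i))"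
  by (auto simp: nf_carrier_def loc_ring_def)

context
  fixes f :: "'r::finite \<Rightarrow> 'n::linorder cpoly"
  assumes f: "\<And>k. f k \<noteq> 0"
begin

lemma zero_in_loc_ring: "0 \<in> loc_ring p"
  using to_fract_in_loc_ring[of 0] by simp

lemma nf_carrier_add: "p \<in> nf_carrier f \<Longrightarrow> q \<in> nf_carrier f \<Longrightarrow> p + q \<in> nf_carrier f"
  using f by (auto simp: nf_carrier_iff lookup_add intro!: loc_ring_add)

lemma nf_carrier_zero: "0 \<in> nf_carrier f"
  by (simp add: nf_carrier_iff zero_in_loc_ring)

lemma nf_carrier_sum: "(\<And>k. k \<in> A \<Longrightarrow> p k \<in> nf_carrier f) \<Longrightarrow> sum p A \<in> nf_carrier f"
  by (induction A rule: infinite_finite_induct) (auto intro: nf_carrier_zero nf_carrier_add)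

lemma nf_carrier_single:
  "a \<in> loc_ring (\<Prod>i\<in>UNIV. f i) \<Longrightarrow> Poly_Mapping.single m a \<in> nf_carrier f"
  by (auto simp: nf_carrier_iff lookup_single when_def zero_in_loc_ring)

lemma nf_carrier_mult:
  assumes "p \<in> nf_carrier f" "q \<in> nf_carrier f" shows "p * q \<in> nf_carrier f"
proof -
  have "p * q = (\<Sum>m\<in>Poly_Mapping.keys p. \<Sum>k\<in>Poly_Mapping.keys q.
      Poly_Mapping.single (m + k) (Poly_Mapping.lookup p m * Poly_Mapping.lookup q k))"
    by (subst (1) poly_mapping_sum_single[of p], subst (1) poly_mapping_sum_single[of q])
       (simp add: sum_product mult_single)
  then show ?thesis
    using assms by (auto simp: nf_carrier_iff[of p] nf_carrier_iff[of q]
        intro!: nf_carrier_sum nf_carrier_single loc_ring_mult)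
qed

lemma nf_carrier_one: "1 \<in> nf_carrier f"
  by (subst single_one[symmetric], rule nf_carrier_single) (use to_fract_in_loc_ring[of 1] in simp)

lemma nf_carrier_power: "p \<in> nf_carrier f \<Longrightarrow> p ^ n \<in> nf_carrier f"
  by (induction n) (auto intro: nf_carrier_one nf_carrier_mult)

lemma nf_carrier_prod: "(\<And>k. k \<in> A \<Longrightarrow> p k \<in> nf_carrier f) \<Longrightarrow> prod p A \<in> nf_carrier f"
  by (induction A rule: infinite_finite_induct) (auto intro: nf_carrier_one nf_carrier_mult)

lemma nf_carrier_mvar: "mvar k \<in> nf_carrier f"
  unfolding mvar_def using to_fract_in_loc_ring[of 1] by (auto intro: nf_carrier_single)

lemma nf_carrier_const: "nf_coeff (to_fract a) \<in> nf_carrier f"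
  unfolding nf_coeff_def by (intro nf_carrier_single to_fract_in_loc_ring)

lemma nf_carrier_uminus: "p \<in> nf_carrier f \<Longrightarrow> - p \<in> nf_carrier f"
  using nf_carrier_mult[OF nf_carrier_const[of "-1"], of p]
  by (simp add: nf_coeff_simps flip: nf_coeff_simps(3))

lemma nf_carrier_inv: "nf_coeff (Fract a (f k)) \<in> nf_carrier f"
proof -
  have "Fract a (f k) = Fract (a * (\<Prod>i\<in>UNIV - {k}. f i)) ((\<Prod>i\<in>UNIV. f i) ^ 1)"
    using f by (simp add: eq_fract prod.remove[of UNIV k])
  then have "Fract a (f k) \<in> loc_ring (\<Prod>i\<in>UNIV. f i)" unfolding loc_ring_def by blast
  then show ?thesis unfolding nf_coeff_def by (rule nf_carrier_single)
qed

lemma nf_carrier_s_shift: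
  assumes "c \<in> {1, - 1}" "p \<in> nf_carrier f" shows "s_shift j c p \<in> nf_carrier f"
proof -
  have c: "nf_coeff c \<in> nf_carrier f"
    using assms(1) nf_carrier_one nf_carrier_uminus[OF nf_carrier_one]
    by (auto simp: nf_coeff_simps simp flip: nf_coeff_simps(3))
  show ?thesis
    using assms(2) c unfolding s_shift_def nf_coeff_def
    by (auto simp: nf_carrier_iff[of p] intro!: nf_carrier_sum nf_carrier_mult nf_carrier_single
        nf_carrier_prod nf_carrier_power nf_carrier_add nf_carrier_mvar nf_carrier_zero)
qed

lemma nf_op_carrier: "h \<in> nf_carrier f \<Longrightarrow> nf_op f a h \<in> nf_carrier f"
proof (cases "(f, a, h)" rule: nf_op.cases)
  case (2 f' j h')
  then have eqs: "a = Der (Inl j)" by simp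
  assume h: "h \<in> nf_carrier f"
  have "Poly_Mapping.map (fract_deriv j) h \<in> nf_carrier f"
    using h f by (auto simp: nf_carrier_iff map_deriv_lookup intro!: loc_ring_deriv)
  with h show ?thesis
    by (auto simp: eqs nf_log_deriv_def intro!: nf_carrier_add nf_carrier_mult nf_carrier_sum
        nf_carrier_mvar nf_carrier_inv)
qed (auto intro!: nf_carrier_mult nf_carrier_const nf_carrier_s_shift nf_carrier_inv nf_carrier_mvar
      nf_carrier_uminus)

theorem nf_act_carrier:
  assumes "h \<in> nf_carrier f" shows "nf_act f P h \<in> nf_carrier f"
proof -
  have "foldr (nf_op f) ws h \<in> nf_carrier f" for ws
    by (induction ws) (auto intro: assms nf_op_carrier)
  then show ?thesis
    unfolding nf_act_def free_act_def nf_scale_def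
    by (intro nf_carrier_sum nf_carrier_mult nf_carrier_const)
qed

end

type_synonym ('n, 'r) dy = "('n + 'r) weyl"

abbreviation dy_x :: "'n \<Rightarrow> ('n, 'r) dy" where "dy_x j \<equiv> weyl_var (Inl j)"
abbreviation dy_t :: "'r \<Rightarrow> ('n, 'r) dy" where "dy_t i \<equiv> weyl_var (Inr i)"
abbreviation dy_dx :: "'n \<Rightarrow> ('n, 'r) dy" where "dy_dx j \<equiv> weyl_der (Inl j)"
abbreviation dy_dt :: "'r \<Rightarrow> ('n, 'r) dy" where "dy_dt i \<equiv> weyl_der (Inr i)"

text \<open>The embedding of \<open>\<complex>[x]\<close>. The \<open>x\<^sub>j\<close> commute, so the order of the factors, which
  \<open>prod_list\<close> has to fix, is irrelevant.\<close>

definition dy_poly :: "'n::linorder cpoly \<Rightarrow> ('n, 'r) dy" where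
  "dy_poly p = (\<Sum>m\<in>Poly_Mapping.keys p. weyl_const (Poly_Mapping.lookup p m) *
     prod_list (map (\<lambda>j. dy_x j ^ Poly_Mapping.lookup m j) (sorted_list_of_set (Poly_Mapping.keys m))))"

definition dy_sigma :: "('n, 'r::finite) dy" where
  "dy_sigma = - (\<Sum>i\<in>UNIV. dy_dt i * dy_t i)"

definition subalgebra :: "'v weyl set \<Rightarrow> bool" where
  "subalgebra A \<longleftrightarrow> range weyl_const \<subseteq> A \<and> (\<forall>P\<in>A. \<forall>Q\<in>A. P + Q \<in> A \<and> P * Q \<in> A)"

definition dx_subalgebra :: "('n, 'r) dy set" where
  "dx_subalgebra = subalgebra hull (range dy_x \<union> range dy_dx)"

definition dx_dt_t_subalgebra :: "('n, 'r) dy set" where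
  "dx_dt_t_subalgebra = subalgebra hull (dx_subalgebra \<union> {- (dy_dt j * dy_t k) | j k. True})"

definition weyl_eval :: "complex poly \<Rightarrow> 'v weyl \<Rightarrow> 'v weyl" where
  "weyl_eval b P = (\<Sum>k\<le>degree b. weyl_const (coeff b k) * P ^ k)"

text \<open>The element \<open>p \<Prod>\<^sub>i f\<^sub>i^s\<^sub>i\<close> for a polynomial \<open>p\<close>.\<close>

definition nf_poly :: "'n::linorder cpoly \<Rightarrow> ('n, 'r) nf" where
  "nf_poly p = nf_coeff (to_fract p)"

definition bernstein_sato_eq ::
  "('r::finite \<Rightarrow> 'n::linorder cpoly) \<Rightarrow> 'n cpoly \<Rightarrow> complex poly \<Rightarrow> bool" where
  "bernstein_sato_eq f g b \<longleftrightarrow>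
     (\<exists>P. (\<forall>j. P j \<in> dx_dt_t_subalgebra) \<and>
        nf_act f (weyl_eval b dy_sigma) (nf_poly g) = (\<Sum>j\<in>UNIV. nf_act f (P j) (nf_poly (g * f j))))"

text \<open>\<open>is_bernstein_sato f g b\<close>: \<open>b\<close> is the polynomial \<open>b\<^bsub>\<aa>,g\<^esub>\<close> of the ideal \<open>\<aa>\<close> generated by
  the \<open>f i\<close>.\<close>

definition is_bernstein_sato ::
  "('r::finite \<Rightarrow> 'n::linorder cpoly) \<Rightarrow> 'n cpoly \<Rightarrow> complex poly \<Rightarrow> bool" where
  "is_bernstein_sato f g b \<longleftrightarrow> lead_coeff b = 1 \<and> bernstein_sato_eq f g b \<and>
     (\<forall>b'. lead_coeff b' = 1 \<and> bernstein_sato_eq f g b' \<longrightarrow> degree b \<le> degree b')"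

text \<open>\<open>D\<^sub>Y[u\<^sub>1,u\<^sub>2]\<close> is \<open>(uvar \<Rightarrow>\<^sub>0 nat) \<Rightarrow>\<^sub>0 ('n, 'r) dy\<close> and \<open>D\<^sub>Y[s]\<close> is \<open>nat \<Rightarrow>\<^sub>0 ('n, 'r) dy\<close>;
  \<open>'a poly\<close> is not available over a noncommutative ring. In both, elements of \<open>D\<^sub>Y\<close> are
  embedded by \<open>Poly_Mapping.single 0\<close>. The intersection of an ideal with a subring is rendered
  as its preimage under the embedding of the subring.\<close>

datatype uvar = U1 | U2

abbreviation dyu :: "('n, 'r) dy \<Rightarrow> (uvar \<Rightarrow>\<^sub>0 nat) \<Rightarrow>\<^sub>0 ('n, 'r) dy" where
  "dyu \<equiv> Poly_Mapping.single 0"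

abbreviation dys :: "('n, 'r) dy \<Rightarrow> nat \<Rightarrow>\<^sub>0 ('n, 'r) dy" where
  "dys \<equiv> Poly_Mapping.single 0"

definition ideal_If ::
  "('r::finite \<Rightarrow> 'n::linorder cpoly) \<Rightarrow> ((uvar \<Rightarrow>\<^sub>0 nat) \<Rightarrow>\<^sub>0 ('n, 'r) dy) set" where
  "ideal_If f =
     left_ideal hull (range (\<lambda>i. dyu (dy_t i) * mvar U1 - dyu (dy_poly (f i))))
   + left_ideal hull (range (\<lambda>j. mvar U1 * dyu (dy_dx j)
                                  + (\<Sum>i\<in>UNIV. dyu (dy_poly (mpderiv j (f i)) * dy_dt i))))
   + left_ideal hull {mvar U1 * mvar U2 - 1}"

definition ideal_1 :: "('r::finite \<Rightarrow> 'n::linorder cpoly) \<Rightarrow> ('n, 'r) dy set" where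
  "ideal_1 f = {P. dyu P \<in> ideal_If f}"

text \<open>\<open>\<complex>[x,s]\<close> is \<open>'n cpoly poly\<close>, polynomials in \<open>s\<close> over \<open>\<complex>[x]\<close>.\<close>

definition dys_poly :: "'n::linorder cpoly poly \<Rightarrow> nat \<Rightarrow>\<^sub>0 ('n, 'r) dy" where
  "dys_poly h = (\<Sum>k\<le>degree h. Poly_Mapping.single k (dy_poly (coeff h k)))"

definition ideal_2 ::
  "('r::finite \<Rightarrow> 'n::linorder cpoly) \<Rightarrow> 'n cpoly \<Rightarrow> 'n cpoly poly set" where
  "ideal_2 f g = {h. dys_poly h \<in> left_ideal hull
     (dys ` ideal_1 f
      \<union> (\<lambda>a. dys (dy_poly (g * a))) ` (left_ideal hull (range f))
      \<union> {Poly_Mapping.single 1 1 - dys dy_sigma})}"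

definition ideal_3 ::
  "('r::finite \<Rightarrow> 'n::linorder cpoly) \<Rightarrow> 'n cpoly \<Rightarrow> 'n cpoly poly set" where
  "ideal_3 f g = colon_ideal (ideal_2 f g) [:g:]"

definition ideal_4 ::
  "('r::finite \<Rightarrow> 'n::linorder cpoly) \<Rightarrow> 'n cpoly \<Rightarrow> complex poly set" where
  "ideal_4 f g = {b. map_poly (Poly_Mapping.single 0) b \<in> ideal_3 f g}"

end

theory Submission
  imports Defs "HOL-Library.Function_Algebras"
begin

text \<open>
  Grade \<open>D\<^sub>Y\<close> by giving \<open>\<partial>\<^bsub>t i\<^esub>\<close> degree \<open>1\<close>, \<open>t\<^sub>i\<close> degree \<open>-1\<close>, and \<open>x\<^sub>j\<close> and \<open>\<partial>\<^bsub>x j\<^esub>\<close> degree \<open>0\<close>. The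
  operators \<open>P\<^sub>j\<close> admitted in the Bernstein--Sato equation are those of degree zero, and so are
  \<open>\<sigma>\<close> and all polynomials in the \<open>x\<^sub>j\<close>. The variable \<open>u\<^sub>1\<close> homogenizes the relations
  \<open>t\<^sub>i = f\<^sub>i\<close> and \<open>\<partial>\<^bsub>x j\<^esub> = - (\<Sum>i. \<partial>f\<^sub>i/\<partial>x\<^sub>j \<partial>\<^bsub>t i\<^esub>)\<close>, which hold for \<open>e = \<Prod>\<^sub>i f\<^sub>i^s\<^sub>i\<close>; so
  \<open>ideal_1 f\<close> consists of the operators all of whose homogeneous components kill \<open>e\<close>. The theorem
  states that a polynomial \<open>b\<close> satisfies the Bernstein--Sato equation if and only if it lies in
  \<open>ideal_4 f g\<close> (\<open>ideal_4_iff\<close>), up to the fact that ideals of polynomials in one variable are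
  principal. Each implication uses one half of this description of \<open>ideal_1 f\<close>.

  If the equation holds, the difference of its two sides gives an operator of degree zero
  that kills \<open>e\<close>, and it must be shown to lie in \<open>ideal_1 f\<close>. Modulo \<open>ideal_If f\<close>, every
  operator of degree zero is a polynomial \<open>q\<close> in the commuting elements \<open>x\<^sub>j\<close> and \<open>u\<^sub>2 \<partial>\<^bsub>t i\<^esub>\<close>
  (\<open>reduce_mod_ideal_If\<close>). Commutators with \<open>\<partial>\<^bsub>x j\<^esub>\<close> and \<open>t\<^sub>k\<close> differentiate \<open>q\<close>, and for any left
  ideal \<open>L\<close> containing \<open>ideal_If f\<close> they show that the polynomials in \<open>L\<close> are closed under
  partial derivatives (\<open>reduced_mpderiv_mem\<close>). A nonzero \<open>q\<close> in \<open>L\<close> could thus be differentiated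
  down to a nonzero constant, so if \<open>L\<close> is proper, an operator of degree zero in \<open>L\<close> already
  lies in \<open>ideal_If f\<close> (\<open>degree_zero_mem_ideal_1\<close>). This is applied to an annihilator \<open>L\<close>.

  For the other direction, let \<open>D\<^sub>Y[s]\<close> act on \<open>N\<^sub>f[u, 1/u]\<close>, where an operator of degree \<open>d\<close>
  carries along a factor \<open>u\<^sup>d\<close> and \<open>s\<close> acts as \<open>\<sigma> - d\<close> in degree \<open>d\<close>; this commutes with
  \<open>D\<^sub>Y\<close>. Then \<open>ideal_1 f\<close> and \<open>s - \<sigma>\<close> kill \<open>e\<close> in degree zero, and the multiples of the
  \<open>g f\<^sub>j\<close> map \<open>e\<close> into the submodule generated by the \<open>g f\<^sub>j e\<close>. Its component of
  degree zero contains only combinations of the \<open>g f\<^sub>j e\<close> with coefficients of degree zero, so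
  applying an element \<open>b(s) g\<close> of \<open>ideal_2 f g\<close> to \<open>e\<close> produces a solution of the
  Bernstein--Sato equation (\<open>eval_at_sigma_mem\<close>).
\<close>

section \<open>Ideals and modules\<close>

lemma left_idealD:
  assumes "left_ideal J"
  shows left_ideal_0: "0 \<in> J"
    and left_ideal_add: "a \<in> J \<Longrightarrow> b \<in> J \<Longrightarrow> a + b \<in> J"
    and left_ideal_mult: "a \<in> J \<Longrightarrow> c * a \<in> J"
  using assms by (auto simp: left_ideal_def)

lemma left_ideal_sum: "left_ideal J \<Longrightarrow> (\<And>i. i \<in> S \<Longrightarrow> h i \<in> J) \<Longrightarrow> sum h S \<in> J"
  by (induction S rule: infinite_finite_induct) (auto intro: left_ideal_0 left_ideal_add)

lemma left_ideal_plus: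
  assumes "left_ideal J" "left_ideal K" shows "left_ideal (J + K)"
  unfolding left_ideal_def
proof (intro conjI allI ballI)
  show "0 \<in> J + K"
    using set_plus_intro[OF left_ideal_0[OF assms(1)] left_ideal_0[OF assms(2)]] by simp
  fix a assume "a \<in> J + K"
  then obtain a1 a2 where a: "a = a1 + a2" "a1 \<in> J" "a2 \<in> K" by (rule set_plus_elim)
  show "c * a \<in> J + K" for c
    using a assms by (auto simp: distrib_left intro!: set_plus_intro left_ideal_mult)
  fix b assume "b \<in> J + K"
  then obtain b1 b2 where b: "b = b1 + b2" "b1 \<in> J" "b2 \<in> K" by (rule set_plus_elim)
  have "(a1 + b1) + (a2 + b2) \<in> J + K"
    using a b assms by (intro set_plus_intro left_ideal_add)
  then show "a + b \<in> J + K" using a b by (simp add: algebra_simps)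
qed

lemma left_ideal_subset_plus:
  assumes "left_ideal J" "left_ideal K" shows "J \<subseteq> J + K" "K \<subseteq> J + K"
proof -
  show "J \<subseteq> J + K" using set_plus_intro[OF _ left_ideal_0[OF assms(2)], of _ J] by auto
  show "K \<subseteq> J + K" using set_plus_intro[OF left_ideal_0[OF assms(1)], of _ K] by auto
qed

lemma left_ideal_plus_least:
  "left_ideal L \<Longrightarrow> J \<subseteq> L \<Longrightarrow> K \<subseteq> L \<Longrightarrow> J + K \<subseteq> L"
  by (blast elim: set_plus_elim intro: left_ideal_add)

text \<open>The annihilators used below are annihilators in modules over three rings, the Weyl
  algebra and its extensions by central variables; the locale collects what they share.\<close>

locale ring_action =
  fixes act :: "'a::ring_1 \<Rightarrow> 'm::ab_group_add \<Rightarrow> 'm"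
  assumes add_left: "act (a + b) x = act a x + act b x"
    and add_right: "act a (x + y) = act a x + act a y"
    and mult: "act (a * b) x = act a (act b x)"
    and one: "act 1 x = x"
begin

lemma zero_left [simp]: "act 0 x = 0"
  using add_left[of 0 0 x] by simp

lemma zero_right [simp]: "act a 0 = 0"
  using add_right[of a 0 0] by simp

lemma diff_left: "act (a - b) x = act a x - act b x"
  using add_left[of "a - b" b x] by (simp add: algebra_simps)

lemma uminus_left: "act (- a) x = - act a x"
  using diff_left[of 0 a x] by simp

lemma diff_right: "act a (x - y) = act a x - act a y"
  using add_right[of a "x - y" y] by (simp add: algebra_simps)

lemma sum_left: "act (sum h S) x = (\<Sum>i\<in>S. act (h i) x)"
  by (induction S rule: infinite_finite_induct) (auto simp: add_left)

lemma sum_right: "act a (sum h S) = (\<Sum>i\<in>S. act a (h i))"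
  by (induction S rule: infinite_finite_induct) (auto simp: add_right)

definition stable_under :: "'a set \<Rightarrow> 'm set \<Rightarrow> bool" where
  "stable_under A K \<longleftrightarrow> 0 \<in> K \<and> (\<forall>x\<in>K. \<forall>y\<in>K. x + y \<in> K) \<and> (\<forall>a\<in>A. \<forall>x\<in>K. act a x \<in> K)"

lemma left_ideal_transporter:
  assumes "stable_under UNIV K" shows "left_ideal {a. act a x \<in> K}"
  using assms by (auto simp: stable_under_def left_ideal_def add_left mult)

lemma hull_act_mem:
  assumes "stable_under UNIV K" "\<And>a. a \<in> S \<Longrightarrow> act a x \<in> K" "a \<in> left_ideal hull S"
  shows "act a x \<in> K"
proof -
  have "left_ideal hull S \<subseteq> {a. act a x \<in> K}"
    by (rule hull_minimal) (use assms left_ideal_transporter in auto)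
  with assms show ?thesis by auto
qed

lemma left_ideal_annihilator: "left_ideal {a. act a x = 0}"
  using left_ideal_transporter[of "{0}" x] by (simp add: stable_under_def)

end

text \<open>A module over a ring, on which a commutative monoid acts by module endomorphisms, is a module over
  the monoid ring, whose elements are polynomials in central variables with coefficients in
  the given ring.\<close>

locale monoid_ring_action = ring_action act for act :: "'a::ring_1 \<Rightarrow> 'm::ab_group_add \<Rightarrow> 'm" +
  fixes \<tau> :: "'k::comm_monoid_add \<Rightarrow> 'm \<Rightarrow> 'm"
  assumes tau_zero: "\<tau> 0 x = x"
    and tau_plus: "\<tau> (k + l) x = \<tau> k (\<tau> l x)"
    and tau_add: "\<tau> k (x + y) = \<tau> k x + \<tau> k y"
    and tau_act: "\<tau> k (act a x) = act a (\<tau> k x)"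
begin

definition pact :: "('k \<Rightarrow>\<^sub>0 'a) \<Rightarrow> 'm \<Rightarrow> 'm" where
  "pact p x = (\<Sum>k\<in>Poly_Mapping.keys p. act (Poly_Mapping.lookup p k) (\<tau> k x))"

lemma pact_single: "pact (Poly_Mapping.single k a) x = act a (\<tau> k x)"
  by (cases "a = 0") (auto simp: pact_def)

lemma pact_add_left: "pact (p + q) x = pact p x + pact q x"
  unfolding pact_def
  by (rule setsum_keys_plus_distrib[where f="\<lambda>k a. act a (\<tau> k x)"]) (auto simp: add_left)

lemma pact_add_right: "pact p (x + y) = pact p x + pact p y"
  by (simp add: pact_def tau_add add_right sum.distrib)

lemma tau_0 [simp]: "\<tau> k 0 = 0"
  using tau_add[of k 0 0] by simp

lemma pact_zero [simp]: "pact 0 x = 0"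
  by (simp add: pact_def)

lemma pact_zero_right [simp]: "pact p 0 = 0"
  by (simp add: pact_def)

lemma pact_mult: "pact (p * q) x = pact p (pact q x)"
proof (induction p rule: poly_mapping_single_induct)
  case (single k a)
  show ?case
    by (induction q rule: poly_mapping_single_induct)
       (simp_all add: mult_single pact_single mult tau_plus tau_act distrib_left pact_add_left
         pact_add_right)
qed (simp_all add: pact_add_left distrib_right)

lemma ring_action_pact: "ring_action pact"
proof
  show "pact 1 x = x" for x
    using pact_single[of 0 1 x] by (simp add: tau_zero one)
qed (fact pact_add_left pact_add_right pact_mult)+

end

definition weyl_act :: "(complex \<Rightarrow> 'm \<Rightarrow> 'm) \<Rightarrow> ('v weyl_gen \<Rightarrow> 'm \<Rightarrow> 'm) \<Rightarrow> 'v weyl \<Rightarrow> 'm \<Rightarrow> 'm::comm_monoid_add"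
  where "weyl_act scale op P = free_act scale op (rep_weyl P)"

fun weyl_letter :: "'v weyl_gen \<Rightarrow> 'v weyl" where
  "weyl_letter (Var v) = weyl_var v"
| "weyl_letter (Der v) = weyl_der v"

lemma weyl_letter_abs: "weyl_letter a = abs_weyl (letter a)"
  by (cases a) (simp_all add: weyl_var.abs_eq weyl_der.abs_eq)

context weyl_ops
begin

lemma weyl_act_abs: "weyl_act scale op (abs_weyl p) x = free_act scale op p x"
proof -
  have "weyl_eq (rep_weyl (abs_weyl p)) p"
    using Quotient3_rep_abs[OF Quotient3_weyl] equivp_reflp[OF weyl_eq_equivp] by blast
  then show ?thesis
    using act_ideal[of "rep_weyl (abs_weyl p) - p" x] by (simp add: weyl_act_def weyl_eq_def act_diff)
qed

lemma ring_action_weyl_act: "ring_action (weyl_act scale op)"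
proof
  fix P Q and x y
  show "weyl_act scale op (P + Q) x = weyl_act scale op P x + weyl_act scale op Q x"
    by (induction P rule: weyl.abs_induct, induction Q rule: weyl.abs_induct)
       (simp add: plus_weyl.abs_eq weyl_act_abs act_add)
  show "weyl_act scale op (P * Q) x = weyl_act scale op P (weyl_act scale op Q x)"
    by (induction P rule: weyl.abs_induct, induction Q rule: weyl.abs_induct)
       (simp add: times_weyl.abs_eq weyl_act_abs act_mult)
  show "weyl_act scale op P (x + y) = weyl_act scale op P x + weyl_act scale op P y"
    by (induction P rule: weyl.abs_induct) (simp add: weyl_act_abs act_add_right)
  show "weyl_act scale op 1 x = x"
    by (simp add: one_weyl.abs_eq weyl_act_abs)
qed

lemma weyl_act_const: "weyl_act scale op (weyl_const c) x = scale c x"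
  by (simp add: weyl_const.abs_eq weyl_act_abs act_single)

lemma weyl_act_letter: "weyl_act scale op (weyl_letter a) x = op a x"
  by (simp add: weyl_letter_abs weyl_act_abs act_letter)

lemmas weyl_act_var = weyl_act_letter[of "Var v" for v, simplified]
lemmas weyl_act_der = weyl_act_letter[of "Der v" for v, simplified]

lemma weyl_act_mem:
  assumes "0 \<in> K" "\<And>x y. x \<in> K \<Longrightarrow> y \<in> K \<Longrightarrow> x + y \<in> K"
    and "\<And>c x. x \<in> K \<Longrightarrow> scale c x \<in> K" "\<And>a x. x \<in> K \<Longrightarrow> op a x \<in> K" "x \<in> K"
  shows "weyl_act scale op P x \<in> K"
proof -
  have sum: "(\<And>i. i \<in> S \<Longrightarrow> h i \<in> K) \<Longrightarrow> sum h S \<in> K" for h S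
    by (induction S rule: infinite_finite_induct) (auto intro: assms)
  have "foldr op ws x \<in> K" for ws by (induction ws) (auto intro: assms)
  then show ?thesis unfolding weyl_act_def free_act_def by (intro sum assms)
qed

lemma weyl_act_endo:
  assumes "\<And>x y. T (x + y) = T x + T y"
    and "\<And>c x. T (scale c x) = scale c (T x)" "\<And>a x. T (op a x) = op a (T x)"
  shows "T (weyl_act scale op P x) = weyl_act scale op P (T x)"
proof -
  have 0: "T 0 = 0" using assms(1)[of 0 0] by simp
  have sum: "T (sum h S) = (\<Sum>i\<in>S. T (h i))" for h S
    by (induction S rule: infinite_finite_induct) (auto simp: assms 0)
  have "T (foldr op ws x) = foldr op ws (T x)" for ws by (induction ws) (auto simp: assms)
  then show ?thesis unfolding weyl_act_def free_act_def by (simp add: sum assms)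
qed

end

lemma nf_act_eq_weyl_act: "nf_act f = weyl_act nf_scale (nf_op f)"
  by (rule ext) (simp add: nf_act_def weyl_act_def)

section \<open>Evaluating polynomials at commuting elements\<close>

lemma prod_list_commute:
  fixes a :: "'a::monoid_mult"
  shows "(\<And>b. b \<in> set bs \<Longrightarrow> a * b = b * a) \<Longrightarrow> a * prod_list bs = prod_list bs * a"
proof (induction bs)
  case (Cons b bs)
  then have "a * b = b * a" "a * prod_list bs = prod_list bs * a" by auto
  then have "a * (b * prod_list bs) = b * prod_list bs * a" by (metis mult.assoc)
  then show ?case by simp
qed simp

lemma prod_list_map_mult:
  fixes p q :: "'v \<Rightarrow> 'a::monoid_mult"
  assumes "\<And>v w. p v * q w = q w * p v"
  shows "prod_list (map (\<lambda>v. p v * q v) vs) = prod_list (map p vs) * prod_list (map q vs)"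
proof (induction vs)
  case (Cons v vs)
  have "q v * prod_list (map p vs) = prod_list (map p vs) * q v"
    by (rule prod_list_commute) (auto simp: assms)
  then have "p v * q v * (prod_list (map p vs) * prod_list (map q vs))
      = p v * prod_list (map p vs) * (q v * prod_list (map q vs))"
    by (metis mult.assoc)
  then show ?case using Cons by simp
qed simp

lemma power_commute:
  fixes a b :: "'a::monoid_mult"
  assumes "a * b = b * a" shows "a * b ^ k = b ^ k * a"
  using power_commuting_commutes[OF assms[symmetric], of k] by simp

text \<open>A noncommutative ring has no products over finite sets, so the order of the factors of a
  monomial is fixed by an enumeration of the variables.\<close>

definition eval_comm ::
  "('k::zero \<Rightarrow> 'a::ring_1) \<Rightarrow> ('v \<Rightarrow> 'a) \<Rightarrow> 'v list \<Rightarrow> (('v \<Rightarrow>\<^sub>0 nat) \<Rightarrow>\<^sub>0 'k) \<Rightarrow> 'a" where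
  "eval_comm \<phi> c vs p = (\<Sum>m\<in>Poly_Mapping.keys p. \<phi> (Poly_Mapping.lookup p m) *
     prod_list (map (\<lambda>v. c v ^ Poly_Mapping.lookup m v) vs))"

locale commuting_family =
  fixes \<phi> :: "'k::comm_ring_1 \<Rightarrow> 'a::ring_1" and c :: "'v::finite \<Rightarrow> 'a" and vs :: "'v list"
  assumes phi_add: "\<phi> (a + b) = \<phi> a + \<phi> b"
    and phi_mult: "\<phi> (a * b) = \<phi> a * \<phi> b"
    and phi_one: "\<phi> 1 = 1"
    and phi_c: "\<phi> a * c v = c v * \<phi> a"
    and c_commute: "c v * c w = c w * c v"
    and distinct: "distinct vs"
    and set: "set vs = UNIV"
begin

definition monom_val :: "('v \<Rightarrow>\<^sub>0 nat) \<Rightarrow> 'a" where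
  "monom_val m = prod_list (map (\<lambda>v. c v ^ Poly_Mapping.lookup m v) vs)"

lemma phi_zero: "\<phi> 0 = 0"
  using phi_add[of 0 0] by simp

lemma eval_single: "eval_comm \<phi> c vs (Poly_Mapping.single m a) = \<phi> a * monom_val m"
  by (cases "a = 0") (auto simp: eval_comm_def monom_val_def phi_zero)

lemma eval_add: "eval_comm \<phi> c vs (p + q) = eval_comm \<phi> c vs p + eval_comm \<phi> c vs q"
  unfolding eval_comm_def monom_val_def[symmetric]
  by (rule setsum_keys_plus_distrib[where f="\<lambda>m a. \<phi> a * monom_val m"])
     (auto simp: phi_zero phi_add distrib_right)

lemma eval_zero: "eval_comm \<phi> c vs 0 = 0"
  by (simp add: eval_comm_def)

lemma monom_val_zero: "monom_val 0 = 1"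
proof -
  have "prod_list (map (\<lambda>v. c v ^ Poly_Mapping.lookup 0 v) ws) = 1" for ws
    by (induction ws) auto
  then show ?thesis by (simp add: monom_val_def)
qed

lemma monom_val_add: "monom_val (m + k) = monom_val m * monom_val k"
proof -
  have "c v ^ i * c w ^ j = c w ^ j * c v ^ i" for v w i j
    using power_commute[of "c v ^ i" "c w" j] power_commute[of "c w" "c v" i] c_commute[of v w] by simp
  then show ?thesis
    unfolding monom_val_def lookup_add power_add by (rule prod_list_map_mult)
qed

lemma monom_val_var: "monom_val (Poly_Mapping.single v 1) = c v"
proof -
  have "prod_list (map (\<lambda>w. c w ^ Poly_Mapping.lookup (Poly_Mapping.single v 1) w) ws)
      = (if v \<in> set ws then c v else 1)" if "distinct ws" for ws
    using that by (induction ws) (simp_all add: lookup_single when_def)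
  then show ?thesis using distinct set by (simp add: monom_val_def)
qed

lemma phi_monom_val: "\<phi> a * monom_val m = monom_val m * \<phi> a"
  unfolding monom_val_def
  by (rule prod_list_commute) (auto intro: power_commute phi_c)

lemma eval_mult: "eval_comm \<phi> c vs (p * q) = eval_comm \<phi> c vs p * eval_comm \<phi> c vs q"
proof (induction p rule: poly_mapping_single_induct)
  case (single m a)
  show ?case
  proof (induction q rule: poly_mapping_single_induct)
    case (single k b)
    have "\<phi> a * \<phi> b * (monom_val m * monom_val k) = \<phi> a * monom_val m * (\<phi> b * monom_val k)"
      using phi_monom_val[of b m] by (metis mult.assoc)
    then show ?case by (simp add: mult_single eval_single phi_mult monom_val_add)
  qed (simp_all add: eval_zero eval_add distrib_left)
qed (simp_all add: eval_zero eval_add distrib_right)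

lemma eval_const: "eval_comm \<phi> c vs (Poly_Mapping.single 0 a) = \<phi> a"
  by (simp add: eval_single monom_val_zero)

lemma eval_one: "eval_comm \<phi> c vs 1 = 1"
  using eval_const[of 1] by (simp add: phi_one)

lemma eval_mvar: "eval_comm \<phi> c vs (mvar v) = c v"
  using monom_val_var by (simp add: mvar_def eval_single phi_one)

lemma eval_diff: "eval_comm \<phi> c vs (p - q) = eval_comm \<phi> c vs p - eval_comm \<phi> c vs q"
  using eval_add[of "p - q" q] by (simp add: algebra_simps)

lemma eval_uminus: "eval_comm \<phi> c vs (- p) = - eval_comm \<phi> c vs p"
  using eval_diff[of 0 p] by (simp add: eval_zero)

lemma eval_sum: "eval_comm \<phi> c vs (sum h S) = (\<Sum>i\<in>S. eval_comm \<phi> c vs (h i))"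
  by (induction S rule: infinite_finite_induct) (auto simp: eval_add eval_zero)

lemma eval_commute:
  "eval_comm \<phi> c vs p * eval_comm \<phi> c vs q = eval_comm \<phi> c vs q * eval_comm \<phi> c vs p"
  by (metis eval_mult mult.commute)

end

lemma weyl_const_add: "weyl_const (a + b) = weyl_const a + weyl_const b"
  by (simp add: weyl_const.abs_eq plus_weyl.abs_eq single_add)

lemma weyl_const_mult: "weyl_const (a * b) = weyl_const a * weyl_const b"
  by (simp add: weyl_const.abs_eq times_weyl.abs_eq mult_single)

lemma weyl_const_one [simp]: "weyl_const 1 = 1"
  by (simp add: weyl_const.abs_eq one_weyl.abs_eq)

lemma weyl_const_zero [simp]: "weyl_const 0 = 0"
  by (simp add: weyl_const.abs_eq zero_weyl.abs_eq)

lemma weyl_const_uminus: "weyl_const (- a) = - weyl_const a"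
  using weyl_const_add[of "- a" a] by (simp add: eq_neg_iff_add_eq_0)

lemma weyl_const_commute: "weyl_const a * P = P * weyl_const a"
proof (induction P rule: weyl.abs_induct)
  fix p :: "'a free_weyl"
  have "Poly_Mapping.single 0 a * p = p * Poly_Mapping.single 0 a"
    by (induction p rule: poly_mapping_single_induct) (simp_all add: mult_single mult.commute[of a] distrib_left distrib_right)
  then show "weyl_const a * abs_weyl p = abs_weyl p * weyl_const a"
    by (simp add: weyl_const.abs_eq times_weyl.abs_eq)
qed

abbreviation var_list :: "'n::{finite,linorder} list" where
  "var_list \<equiv> sorted_list_of_set UNIV"

interpretation dy_poly: commuting_family
  "weyl_const :: complex \<Rightarrow> ('n::{finite,linorder}, 'r) dy" dy_x var_list
proof
  show "weyl_const a * dy_x v = dy_x v * weyl_const a" for a and v :: 'n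
    by (rule weyl_const_commute)
  show "dy_x v * dy_x w = dy_x w * dy_x v" for v w :: 'n
    by (rule weyl_var_commute)
qed (simp_all add: weyl_const_add weyl_const_mult)

lemma prod_list_filter:
  fixes h :: "'v \<Rightarrow> 'a::monoid_mult"
  shows "(\<And>v. \<not> P v \<Longrightarrow> h v = 1) \<Longrightarrow> prod_list (map h (filter P vs)) = prod_list (map h vs)"
  by (induction vs) auto

text \<open>The variables that do not occur in a monomial contribute factors \<open>1\<close>. Listing all variables
  instead of the occurring ones makes the order of the factors the same for all monomials, so
  that products of monomials can be computed.\<close>

lemma dy_poly_eq_eval:
  "dy_poly = (eval_comm weyl_const dy_x var_list :: 'n::{finite,linorder} cpoly \<Rightarrow> ('n, 'r) dy)"
proof (rule ext)
  fix p :: "'n cpoly"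
  have "prod_list (map (\<lambda>j. (dy_x j :: ('n, 'r) dy) ^ Poly_Mapping.lookup m j)
          (sorted_list_of_set (Poly_Mapping.keys m)))
      = prod_list (map (\<lambda>j. dy_x j ^ Poly_Mapping.lookup m j) var_list)" for m :: "'n \<Rightarrow>\<^sub>0 nat"
  proof -
    have "sorted_list_of_set (Poly_Mapping.keys m) = filter (\<lambda>j. j \<in> Poly_Mapping.keys m) var_list"
      by (rule sorted_distinct_set_unique) (auto intro: sorted_wrt_filter)
    then show ?thesis by (simp only:) (rule prod_list_filter, simp add: in_keys_iff)
  qed
  then show "dy_poly p = (eval_comm weyl_const dy_x var_list p :: ('n, 'r) dy)"
    by (simp add: dy_poly_def eval_comm_def)
qed

lemmas dy_poly_add = dy_poly.eval_add[folded dy_poly_eq_eval]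
lemmas dy_poly_mult = dy_poly.eval_mult[folded dy_poly_eq_eval]
lemmas dy_poly_const = dy_poly.eval_const[folded dy_poly_eq_eval]
lemmas dy_poly_mvar = dy_poly.eval_mvar[folded dy_poly_eq_eval]
lemmas dy_poly_zero = dy_poly.eval_zero[folded dy_poly_eq_eval]

section \<open>Differentiating down to a constant\<close>

lemma lookup_mpderiv:
  "Poly_Mapping.lookup (mpderiv v p) m
    = of_nat (Poly_Mapping.lookup m v + 1) * Poly_Mapping.lookup p (m + Poly_Mapping.single v 1)"
proof (induction p rule: poly_mapping_single_induct)
  case (single k c)
  show ?case
  proof (cases "Poly_Mapping.lookup k v = 0")
    case True
    then have "k \<noteq> m + Poly_Mapping.single v 1" by (auto simp: lookup_add)
    then show ?thesis using True by (simp add: mpderiv_single lookup_single when_def)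
  next
    case False
    then have "k - Poly_Mapping.single v 1 + Poly_Mapping.single v 1 = k"
      by (intro poly_mapping_eqI) (auto simp: lookup_add lookup_minus lookup_single when_def)
    then have "k - Poly_Mapping.single v 1 = m \<longleftrightarrow> k = m + Poly_Mapping.single v 1"
      by (metis add_diff_cancel_right')
    then show ?thesis by (auto simp: mpderiv_single lookup_single when_def lookup_add)
  qed
qed (simp_all add: mpderiv_add lookup_add distrib_left)

text \<open>In characteristic zero, a polynomial all of whose partial derivatives vanish is constant.
  Otherwise some derivative is nonzero and of smaller degree, so the process ends at a nonzero
  constant.\<close>

lemma derivation_closed_constant:
  fixes K :: "'v::finite cpoly set"
  assumes closed: "\<And>v q. q \<in> K \<Longrightarrow> mpderiv v q \<in> K" and "q \<in> K" "q \<noteq> 0"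
  shows "\<exists>c. c \<noteq> 0 \<and> Poly_Mapping.single 0 c \<in> K"
proof -
  let ?deg = "\<lambda>m :: 'v \<Rightarrow>\<^sub>0 nat. \<Sum>v\<in>UNIV. Poly_Mapping.lookup m v"
  have deg_add: "?deg (m + Poly_Mapping.single v 1) = Suc (?deg m)" for m v
    by (simp add: lookup_add lookup_single when_def sum.distrib)
  have "\<exists>c. c \<noteq> 0 \<and> Poly_Mapping.single 0 c \<in> K"
    if "q \<in> K" "q \<noteq> 0" "\<forall>m\<in>Poly_Mapping.keys q. ?deg m \<le> d" for d q
    using that
  proof (induction d arbitrary: q)
    case 0
    then have "m = 0" if "m \<in> Poly_Mapping.keys q" for m
      using that by (intro poly_mapping_eqI) auto
    then have "q = Poly_Mapping.single 0 (Poly_Mapping.lookup q 0)"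
      by (intro poly_mapping_eqI) (force simp: lookup_single when_def in_keys_iff)
    with 0 show ?case by (metis single_zero)
  next
    case (Suc d)
    show ?case
    proof (cases "\<exists>v. mpderiv v q \<noteq> 0")
      case True
      then obtain v where v: "mpderiv v q \<noteq> 0" by blast
      have "?deg m \<le> d" if "m \<in> Poly_Mapping.keys (mpderiv v q)" for m
      proof -
        have "m + Poly_Mapping.single v 1 \<in> Poly_Mapping.keys q"
          using that by (auto simp: in_keys_iff lookup_mpderiv)
        then show ?thesis using Suc.prems(3) deg_add[of m v] by fastforce
      qed
      with v Suc.IH[of "mpderiv v q"] Suc.prems closed show ?thesis by blast
    next
      case False
      have "m = 0" if m: "m \<in> Poly_Mapping.keys q" for m
      proof (rule poly_mapping_eqI)
        fix v
        show "Poly_Mapping.lookup m v = Poly_Mapping.lookup 0 v"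
        proof (rule ccontr)
          assume nz: "Poly_Mapping.lookup m v \<noteq> Poly_Mapping.lookup 0 v"
          then have "m - Poly_Mapping.single v 1 + Poly_Mapping.single v 1 = m"
            by (intro poly_mapping_eqI) (auto simp: lookup_add lookup_minus lookup_single when_def)
          with lookup_mpderiv[of v q "m - Poly_Mapping.single v 1"] False
          have "of_nat (Poly_Mapping.lookup (m - Poly_Mapping.single v 1) v + 1) * Poly_Mapping.lookup q m = (0::complex)"
            by (metis lookup_zero)
          moreover have "of_nat (Poly_Mapping.lookup (m - Poly_Mapping.single v 1) v + 1) \<noteq> (0::complex)"
            by (simp only: of_nat_eq_0_iff)
          ultimately show False using m by (simp add: in_keys_iff)
        qed
      qed
      then have "q = Poly_Mapping.single 0 (Poly_Mapping.lookup q 0)"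
        by (intro poly_mapping_eqI) (force simp: lookup_single when_def in_keys_iff)
      with Suc.prems show ?thesis by (metis single_zero)
    qed
  qed
  moreover have "\<forall>m\<in>Poly_Mapping.keys q. ?deg m \<le> (\<Sum>m\<in>Poly_Mapping.keys q. ?deg m)"
    by (auto intro: member_le_sum[where f="?deg"])
  ultimately show ?thesis using assms(2,3) by blast
qed

section \<open>Reduction of degree-zero operators modulo the ideal\<close>

lemma mvar_central:
  fixes p :: "('v \<Rightarrow>\<^sub>0 nat) \<Rightarrow>\<^sub>0 'a::ring_1"
  shows "mvar v * p = p * mvar v"
  by (induction p rule: poly_mapping_single_induct)
     (simp_all add: mvar_def mult_single distrib_left distrib_right add.commute)

lemma mvar_left_commute:
  fixes p :: "('v \<Rightarrow>\<^sub>0 nat) \<Rightarrow>\<^sub>0 'a::ring_1"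
  shows "p * (mvar v * q) = mvar v * (p * q)"
  by (metis mvar_central mult.assoc)

lemma single_mvar_commute:
  fixes q :: "('v \<Rightarrow>\<^sub>0 nat) \<Rightarrow>\<^sub>0 'a::ring_1"
  shows "Poly_Mapping.single 0 a * (mvar v * q) = mvar v * (Poly_Mapping.single 0 a * q)"
  by (rule mvar_left_commute)

lemma single_0_mult: "Poly_Mapping.single 0 (a * b) = Poly_Mapping.single 0 a * Poly_Mapping.single 0 b"
  by (simp add: mult_single)

lemma single_0_sum: "Poly_Mapping.single 0 (sum h S) = (\<Sum>i\<in>S. Poly_Mapping.single 0 (h i))"
  by (induction S rule: infinite_finite_induct) (auto simp: single_add)

text \<open>If the commutators with \<open>y\<close> of the elements \<open>c v\<close> are those of the partial derivative in
  direction \<open>w\<close>, up to a central factor \<open>z\<close>, then so are the commutators of all their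
  polynomials, because both sides are derivations.\<close>

lemma eval_commutator:
  fixes \<phi> :: "complex \<Rightarrow> 'a::ring_1" and c :: "'v::finite \<Rightarrow> 'a"
  assumes "commuting_family \<phi> c vs"
    and y_phi: "\<And>a. y * \<phi> a = \<phi> a * y"
    and y_c: "\<And>v. y * c v = c v * y + (if v = w then z else 0)"
    and z: "\<And>a. z * a = a * z"
  shows "y * eval_comm \<phi> c vs q = eval_comm \<phi> c vs q * y + z * eval_comm \<phi> c vs (mpderiv w q)"
proof -
  interpret commuting_family \<phi> c vs by fact
  let ?R = "eval_comm \<phi> c vs"
  show ?thesis
  proof (induction q rule: mult_induct_single)
    case (const a)
    then show ?case by (simp add: eval_const y_phi mpderiv_single eval_zero)
  next
    case (mvar v)
    then show ?case by (auto simp: eval_mvar y_c mpderiv_mvar eval_zero eval_one)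
  next
    case (add p q)
    then show ?case by (simp add: eval_add mpderiv_add algebra_simps)
  next
    case (mult p q)
    have "y * (?R p * ?R q) = (?R p * y + z * ?R (mpderiv w p)) * ?R q"
      using mult(1) by (simp flip: mult.assoc)
    also have "\<dots> = ?R p * (?R q * y + z * ?R (mpderiv w q)) + z * ?R (mpderiv w p) * ?R q"
      using mult(2) by (simp add: distrib_right mult.assoc)
    also have "\<dots> = ?R p * ?R q * y + z * (?R (mpderiv w p) * ?R q + ?R p * ?R (mpderiv w q))"
    proof -
      have "?R p * (z * ?R (mpderiv w q)) = z * (?R p * ?R (mpderiv w q))"
        by (metis z mult.assoc)
      then show ?thesis by (simp add: distrib_left mult.assoc)
    qed
    finally show ?case by (simp add: eval_mult eval_add mpderiv_mult)
  qed (simp add: eval_zero)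
qed

definition enum_list :: "'v::finite list" where
  "enum_list = (SOME vs. distinct vs \<and> set vs = UNIV)"

lemma enum_list: "distinct (enum_list :: 'v::finite list)" "set (enum_list :: 'v list) = UNIV"
proof -
  have "\<exists>vs :: 'v list. distinct vs \<and> set vs = UNIV"
    using finite_distinct_list[of "UNIV :: 'v set"] by auto
  then show "distinct (enum_list :: 'v list)" "set (enum_list :: 'v list) = UNIV"
    unfolding enum_list_def by (rule someI2_ex, blast)+
qed

type_synonym ('n, 'r) dy_u = "(uvar \<Rightarrow>\<^sub>0 nat) \<Rightarrow>\<^sub>0 ('n, 'r) dy"

text \<open>Modulo \<open>u\<^sub>1 u\<^sub>2 - 1\<close>, the ideal \<open>ideal_If f\<close> contains the elements \<open>t\<^sub>k - u\<^sub>2 f\<^sub>k\<close> and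
  \<open>\<partial>\<^bsub>x j\<^esub> + (\<Sum>i. \<partial>f\<^sub>i/\<partial>x\<^sub>j u\<^sub>2 \<partial>\<^bsub>t i\<^esub>)\<close>, so \<open>t\<^sub>k\<close> and \<open>\<partial>\<^bsub>x j\<^esub>\<close> can be eliminated. An operator of
  degree zero is thereby rewritten as a polynomial in the commuting elements \<open>x\<^sub>j\<close> and
  \<open>u\<^sub>2 \<partial>\<^bsub>t i\<^esub>\<close>, in which \<open>u\<^sub>2\<close> keeps the degree at zero.\<close>

fun reduced_var :: "'n + 'r \<Rightarrow> ('n, 'r) dy_u" where
  "reduced_var (Inl j) = dyu (dy_x j)"
| "reduced_var (Inr i) = mvar U2 * dyu (dy_dt i)"

definition reduced :: "('n::finite + 'r::finite) cpoly \<Rightarrow> ('n, 'r) dy_u" where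
  "reduced = eval_comm (\<lambda>a. dyu (weyl_const a)) reduced_var enum_list"

interpretation reduced: commuting_family
  "\<lambda>a. dyu (weyl_const a) :: ('n::finite, 'r::finite) dy_u" reduced_var enum_list
proof
  fix v w :: "'n + 'r" and a
  show "dyu (weyl_const a) * reduced_var v = reduced_var v * dyu (weyl_const a)"
    by (cases v) (simp_all add: single_mvar_commute mult.assoc mult_single weyl_const_commute)
  show "reduced_var v * reduced_var w = reduced_var w * reduced_var v"
  proof (cases v; cases w)
    fix i k assume vw: "v = Inr i" "w = Inr k"
    have "mvar U2 * (dyu (dy_dt i) * (mvar U2 * dyu (dy_dt k)))
        = mvar U2 * (mvar U2 * (dyu (dy_dt k) * dyu (dy_dt i) :: ('n, 'r) dy_u))"
      by (simp add: single_mvar_commute mult_single weyl_der_commute)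
    then show ?thesis by (simp add: vw single_mvar_commute mult.assoc)
  qed (simp_all add: single_mvar_commute mult.assoc mult_single weyl_var_commute weyl_der_var)
qed (simp_all add: single_add weyl_const_add weyl_const_mult mult_single enum_list)

lemmas reduced_simps =
  reduced.eval_add[folded reduced_def] reduced.eval_diff[folded reduced_def]
  reduced.eval_uminus[folded reduced_def] reduced.eval_mult[folded reduced_def]
  reduced.eval_zero[folded reduced_def] reduced.eval_one[folded reduced_def]
  reduced.eval_const[folded reduced_def] reduced.eval_mvar[folded reduced_def]
  reduced.eval_sum[folded reduced_def]

lemmas reduced_commute = reduced.eval_commute[folded reduced_def]

lemma reduced_dy_poly: "\<exists>q :: ('n::{finite,linorder} + 'r::finite) cpoly. reduced q = dyu (dy_poly p)"
proof (induction p rule: mult_induct_single)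
  case zero
  show ?case by (rule exI[of _ 0]) (simp add: reduced_simps dy_poly_zero)
next
  case (const a)
  show ?case by (rule exI[of _ "Poly_Mapping.single 0 a"]) (simp add: reduced_simps dy_poly_const)
next
  case (mvar j)
  show ?case by (rule exI[of _ "mvar (Inl j)"]) (simp add: reduced_simps dy_poly_mvar)
next
  case (add p q)
  then show ?case by (metis reduced_simps(1) dy_poly_add single_add)
next
  case (mult p q)
  then show ?case by (metis reduced_simps(4) dy_poly_mult single_0_mult)
qed

lemma dx_reduced:
  "dyu (dy_dx j) * reduced q = reduced q * dyu (dy_dx j) + reduced (mpderiv (Inl j) q)"
proof -
  have "dyu (dy_dx j) * reduced q = reduced q * dyu (dy_dx j) + 1 * reduced (mpderiv (Inl j) q)"
    unfolding reduced_def
  proof (rule eval_commutator[OF reduced.commuting_family_axioms])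
    show "dyu (dy_dx j) * dyu (weyl_const a) = dyu (weyl_const a) * dyu (dy_dx j)" for a
      by (simp add: mult_single weyl_const_commute)
    show "dyu (dy_dx j) * reduced_var v = reduced_var v * dyu (dy_dx j) + (if v = Inl j then 1 else 0)" for v
      by (cases v) (auto simp: single_mvar_commute mult.assoc mult_single weyl_der_var weyl_der_commute single_add)
  qed simp
  then show ?thesis by simp
qed

lemma t_reduced:
  fixes q :: "('n::finite + 'r::finite) cpoly"
  shows
  "dyu (dy_t k) * reduced q = reduced q * dyu (dy_t k) - mvar U2 * reduced (mpderiv (Inr k) q)"
proof -
  have "dyu (dy_t k) * reduced q = reduced q * dyu (dy_t k) + (- mvar U2) * reduced (mpderiv (Inr k) q)"
    unfolding reduced_def
  proof (rule eval_commutator[OF reduced.commuting_family_axioms])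
    show "dyu (dy_t k) * dyu (weyl_const a) = dyu (weyl_const a) * dyu (dy_t k)" for a
      by (simp add: mult_single weyl_const_commute)
    show "dyu (dy_t k) * reduced_var v = reduced_var v * dyu (dy_t k) + (if v = Inr k then - mvar U2 else 0)" for v :: "'n + 'r"
    proof (cases v)
      case (Inr i)
      have "dyu (dy_t k) * dyu (dy_dt i) = dyu (dy_dt i) * dyu (dy_t k) - (if i = k then 1 else (0 :: ('n, 'r) dy_u))"
        by (auto simp: mult_single weyl_der_var single_add)
      then show ?thesis
        by (auto simp add: Inr single_mvar_commute mult.assoc right_diff_distrib)
    qed (simp add: mult_single weyl_var_commute)
  qed (simp add: mvar_central)
  then show ?thesis by simp
qed

lemma left_ideal_If: "left_ideal (ideal_If f)"
  unfolding ideal_If_def by (intro left_ideal_plus left_ideal_hull)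

lemma generators_ideal_If:
  fixes f :: "'r::finite \<Rightarrow> 'n::linorder cpoly"
  shows t_ideal_If: "dyu (dy_t i) * mvar U1 - dyu (dy_poly (f i)) \<in> ideal_If f"
    and dx_ideal_If: "mvar U1 * dyu (dy_dx j)
      + (\<Sum>i\<in>UNIV. dyu (dy_poly (mpderiv j (f i)) * dy_dt i)) \<in> ideal_If f"
    and u_ideal_If: "mvar U1 * mvar U2 - 1 \<in> ideal_If f"
proof -
  let ?T = "left_ideal hull (range (\<lambda>i. dyu (dy_t i) * mvar U1 - dyu (dy_poly (f i))))"
  let ?X = "left_ideal hull (range (\<lambda>j. mvar U1 * dyu (dy_dx j)
              + (\<Sum>i\<in>UNIV. dyu (dy_poly (mpderiv j (f i)) * dy_dt i))))"
  let ?U = "left_ideal hull {mvar U1 * mvar U2 - 1 :: ('n, 'r) dy_u}"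
  have sub: "?T \<subseteq> ideal_If f" "?X \<subseteq> ideal_If f" "?U \<subseteq> ideal_If f"
    unfolding ideal_If_def
    using left_ideal_subset_plus[OF left_ideal_hull[of "range (\<lambda>i. dyu (dy_t i) * mvar U1 - dyu (dy_poly (f i)))"]
        left_ideal_hull[of "range (\<lambda>j. mvar U1 * dyu (dy_dx j)
              + (\<Sum>i\<in>UNIV. dyu (dy_poly (mpderiv j (f i)) * dy_dt i)))"]]
      left_ideal_subset_plus[OF left_ideal_plus[OF left_ideal_hull left_ideal_hull] left_ideal_hull]
    by blast+
  show "dyu (dy_t i) * mvar U1 - dyu (dy_poly (f i)) \<in> ideal_If f"
    by (rule subsetD[OF sub(1)], rule hull_inc) (rule rangeI)
  show "mvar U1 * dyu (dy_dx j) + (\<Sum>i\<in>UNIV. dyu (dy_poly (mpderiv j (f i)) * dy_dt i)) \<in> ideal_If f"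
    by (rule subsetD[OF sub(2)], rule hull_inc) (rule rangeI)
  show "mvar U1 * mvar U2 - 1 \<in> ideal_If f"
    by (rule subsetD[OF sub(3)], rule hull_inc) simp
qed


text \<open>These relations come from \<open>u\<^sub>2\<close> times the generators of \<open>ideal_If f\<close>, after replacing
  \<open>u\<^sub>1 u\<^sub>2\<close> by \<open>1\<close>.\<close>

lemma ideal_If_relations:
  fixes f :: "'r::finite \<Rightarrow> 'n::{finite,linorder} cpoly"
  shows "\<exists>(a :: 'r \<Rightarrow> ('n + 'r) cpoly) (b :: 'n \<Rightarrow> ('n + 'r) cpoly).
    (\<forall>k. dyu (dy_t k) - mvar U2 * reduced (a k) \<in> ideal_If f) \<and>
    (\<forall>j. dyu (dy_dx j) + reduced (b j) \<in> ideal_If f)"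
proof -
  let ?I = "ideal_If f"
  note I = left_ideal_If[of f]
  have uu: "p * (mvar U1 * mvar U2 - 1) \<in> ?I" for p
    by (rule left_ideal_mult[OF I u_ideal_If])
  define \<rho> where "\<rho> p = (SOME q :: ('n + 'r) cpoly. reduced q = dyu (dy_poly p))" for p
  have \<rho>: "reduced (\<rho> p) = dyu (dy_poly p)" for p
    unfolding \<rho>_def by (rule someI_ex[OF reduced_dy_poly])
  have "dyu (dy_t k) - mvar U2 * reduced (\<rho> (f k)) \<in> ?I" for k
  proof -
    have "mvar U2 * (dyu (dy_t k) * mvar U1 - dyu (dy_poly (f k)))
        - dyu (dy_t k) * (mvar U1 * mvar U2 - 1) \<in> ?I"
      by (intro left_ideal_diff[OF I] left_ideal_mult[OF I] uu t_ideal_If)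
    moreover have "mvar U2 * (dyu (dy_t k) * mvar U1) = (dyu (dy_t k) * (mvar U1 * mvar U2) :: ('n, 'r) dy_u)"
      by (simp add: mvar_central[of U2 "_ * mvar U1"] mult.assoc)
    ultimately show ?thesis by (simp add: \<rho> right_diff_distrib algebra_simps)
  qed
  moreover have "dyu (dy_dx j) + reduced (\<Sum>i\<in>UNIV. \<rho> (mpderiv j (f i)) * mvar (Inr i)) \<in> ?I" for j
  proof -
    have "mvar U2 * (mvar U1 * dyu (dy_dx j) + (\<Sum>i\<in>UNIV. dyu (dy_poly (mpderiv j (f i)) * dy_dt i)))
        - dyu (dy_dx j) * (mvar U1 * mvar U2 - 1) \<in> ?I"
      by (intro left_ideal_diff[OF I] left_ideal_mult[OF I] uu dx_ideal_If)
    moreover have "mvar U2 * (mvar U1 * dyu (dy_dx j)) = (dyu (dy_dx j) * (mvar U1 * mvar U2) :: ('n, 'r) dy_u)"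
      by (simp add: mvar_left_commute[of _ U1] mvar_central[of U2 "dyu _"])
    moreover have "mvar U2 * (\<Sum>i\<in>UNIV. dyu (dy_poly (mpderiv j (f i)) * dy_dt i))
        = reduced (\<Sum>i\<in>UNIV. \<rho> (mpderiv j (f i)) * mvar (Inr i))"
      by (simp add: reduced_simps \<rho> sum_distrib_left single_0_mult single_mvar_commute)
    ultimately show ?thesis by (simp add: distrib_left right_diff_distrib algebra_simps)
  qed
  ultimately show ?thesis
    by (intro exI[of _ "\<lambda>k. \<rho> (f k)"]
        exI[of _ "\<lambda>j. \<Sum>i\<in>UNIV. \<rho> (mpderiv j (f i)) * mvar (Inr i)"]) auto
qed

lemma subalgebra_hull: "subalgebra (subalgebra hull S)"
  by (rule hull_in) (auto simp: subalgebra_def)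

lemma dx_dt_t_subalgebra_subset:
  assumes S: "subalgebra S" and "range dy_x \<subseteq> S" "range dy_dx \<subseteq> S"
    and "\<And>j k. - (dy_dt j * dy_t k) \<in> S"
  shows "dx_dt_t_subalgebra \<subseteq> S"
proof -
  have "dx_subalgebra \<subseteq> S"
    unfolding dx_subalgebra_def by (rule hull_minimal) (use assms in auto)
  then show ?thesis
    unfolding dx_dt_t_subalgebra_def by (intro hull_minimal) (use assms in auto)
qed

text \<open>The operators that map reduced elements to reduced elements modulo \<open>ideal_If f\<close> form a
  subalgebra, so only the generators of the degree-zero part have to be checked. For \<open>\<partial>\<^bsub>x j\<^esub>\<close> and
  \<open>t\<^sub>k\<close>, the operator is moved to the right of the reduced element, which differentiates that
  element, and is then eliminated by the relations above.\<close>

lemma reduce_mod_ideal_If: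
  fixes f :: "'r::finite \<Rightarrow> 'n::{finite,linorder} cpoly"
  assumes "P \<in> dx_dt_t_subalgebra"
  shows "\<exists>q. dyu P - reduced q \<in> ideal_If f"
proof -
  let ?I = "ideal_If f"
  note I = left_ideal_If[of f]
  let ?S = "{P :: ('n, 'r) dy. \<forall>p. \<exists>q. dyu P * reduced p - reduced q \<in> ?I}"
  obtain a :: "'r \<Rightarrow> ('n + 'r) cpoly" and b :: "'n \<Rightarrow> ('n + 'r) cpoly"
    where a: "\<And>k. dyu (dy_t k) - mvar U2 * reduced (a k) \<in> ?I"
      and b: "\<And>j. dyu (dy_dx j) + reduced (b j) \<in> ?I"
    using ideal_If_relations[of f] by blast
  have "dx_dt_t_subalgebra \<subseteq> ?S"
  proof (rule dx_dt_t_subalgebra_subset)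
    show "subalgebra ?S"
      unfolding subalgebra_def
    proof (intro conjI ballI)
      show "range weyl_const \<subseteq> ?S"
      proof (intro subsetI CollectI allI)
        fix P :: "('n, 'r) dy" and p :: "('n + 'r) cpoly"
        assume "P \<in> range weyl_const"
        then obtain c where "P = weyl_const c" by blast
        then have "dyu P * reduced p - reduced (Poly_Mapping.single 0 c * p) \<in> ?I"
          using left_ideal_0[OF I] by (simp add: reduced_simps)
        then show "\<exists>q. dyu P * reduced p - reduced q \<in> ?I" ..
      qed
      fix P Q assume PQ: "P \<in> ?S" "Q \<in> ?S"
      show "P + Q \<in> ?S"
      proof (intro CollectI allI)
        fix p :: "('n + 'r) cpoly"
        obtain q q' where "dyu P * reduced p - reduced q \<in> ?I" "dyu Q * reduced p - reduced q' \<in> ?I"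
          using PQ by blast
        from left_ideal_add[OF I this] have "dyu (P + Q) * reduced p - reduced (q + q') \<in> ?I"
          by (simp add: reduced_simps single_add algebra_simps)
        then show "\<exists>q. dyu (P + Q) * reduced p - reduced q \<in> ?I" ..
      qed
      show "P * Q \<in> ?S"
      proof (intro CollectI allI)
        fix p :: "('n + 'r) cpoly"
        obtain q where q: "dyu Q * reduced p - reduced q \<in> ?I" using PQ by blast
        obtain q' where q': "dyu P * reduced q - reduced q' \<in> ?I" using PQ by blast
        have "dyu P * (dyu Q * reduced p - reduced q) + (dyu P * reduced q - reduced q') \<in> ?I"
          by (intro left_ideal_add[OF I] left_ideal_mult[OF I] q q')
        then have "dyu (P * Q) * reduced p - reduced q' \<in> ?I"
          by (simp add: right_diff_distrib single_0_mult mult.assoc)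
        then show "\<exists>q. dyu (P * Q) * reduced p - reduced q \<in> ?I" ..
      qed
    qed
    show "range dy_x \<subseteq> ?S"
    proof (intro subsetI CollectI allI)
      fix P :: "('n, 'r) dy" and p :: "('n + 'r) cpoly"
      assume "P \<in> range dy_x"
      then obtain j where "P = dy_x j" by blast
      then have "dyu P * reduced p - reduced (mvar (Inl j) * p) \<in> ?I"
        using left_ideal_0[OF I] by (simp add: reduced_simps)
      then show "\<exists>q. dyu P * reduced p - reduced q \<in> ?I" ..
    qed
    show "range dy_dx \<subseteq> ?S"
    proof (intro subsetI CollectI allI)
      fix P :: "('n, 'r) dy" and p :: "('n + 'r) cpoly"
      assume "P \<in> range dy_dx"
      then obtain j where P: "P = dy_dx j" by blast
      have "reduced p * (dyu (dy_dx j) + reduced (b j)) \<in> ?I"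
        by (rule left_ideal_mult[OF I b])
      then have "dyu P * reduced p - reduced (mpderiv (Inl j) p - p * b j) \<in> ?I"
        by (simp add: P dx_reduced reduced_simps distrib_left)
      then show "\<exists>q. dyu P * reduced p - reduced q \<in> ?I" ..
    qed
    show "- (dy_dt j * dy_t k) \<in> ?S" for j k
    proof (intro CollectI allI)
      fix p :: "('n + 'r) cpoly"
      let ?q = "mvar (Inr j) * (p * a k - mpderiv (Inr k) p)"
      have "(- (dyu (dy_dt j) * reduced p)) * (dyu (dy_t k) - mvar U2 * reduced (a k)) \<in> ?I"
        by (rule left_ideal_mult[OF I a])
      moreover have "(- (dyu (dy_dt j) * reduced p)) * (dyu (dy_t k) - mvar U2 * reduced (a k))
        = dyu (- (dy_dt j * dy_t k)) * reduced p - reduced (- ?q)"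
      proof -
        have "dyu (dy_dt j) * (reduced p * (mvar U2 * reduced (a k))) = reduced (mvar (Inr j) * (p * a k))"
          by (simp add: reduced_simps mvar_left_commute[of "reduced p"] single_mvar_commute mult.assoc)
        moreover have "dyu (dy_dt j * dy_t k) * reduced p
            = dyu (dy_dt j) * (reduced p * dyu (dy_t k)) - reduced (mvar (Inr j) * mpderiv (Inr k) p)"
          by (simp add: single_0_mult mult.assoc t_reduced right_diff_distrib reduced_simps single_mvar_commute)
        ultimately show ?thesis
          by (simp add: single_uminus right_diff_distrib mult.assoc reduced_simps)
      qed
      ultimately have "dyu (- (dy_dt j * dy_t k)) * reduced p - reduced (- ?q) \<in> ?I" by simp
      then show "\<exists>q. dyu (- (dy_dt j * dy_t k)) * reduced p - reduced q \<in> ?I" ..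
    qed
  qed
  with assms have "\<exists>q. dyu P * reduced 1 - reduced q \<in> ?I" by blast
  then show ?thesis by (simp add: reduced_simps)
qed

text \<open>The partial derivatives are commutators with \<open>\<partial>\<^bsub>x j\<^esub>\<close> and \<open>t\<^sub>k\<close>. The product with the operator on
  the left is in the left ideal anyway; in the other product the relations replace the operator
  by a reduced element, which commutes with the given one.\<close>

lemma reduced_mpderiv_mem:
  fixes f :: "'r::finite \<Rightarrow> 'n::{finite,linorder} cpoly"
  assumes L: "left_ideal L" "ideal_If f \<subseteq> L" and q: "reduced q \<in> L"
  shows "reduced (mpderiv v q) \<in> L"
proof -
  obtain a :: "'r \<Rightarrow> ('n + 'r) cpoly" and b :: "'n \<Rightarrow> ('n + 'r) cpoly"
    where a: "\<And>k. dyu (dy_t k) - mvar U2 * reduced (a k) \<in> L"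
      and b: "\<And>j. dyu (dy_dx j) + reduced (b j) \<in> L"
    using ideal_If_relations[of f] L(2) by blast
  show ?thesis
  proof (cases v)
    case (Inl j)
    have "dyu (dy_dx j) * reduced q - reduced q * (dyu (dy_dx j) + reduced (b j)) + reduced (b j) * reduced q \<in> L"
      by (intro left_ideal_add[OF L(1)] left_ideal_diff[OF L(1)] left_ideal_mult[OF L(1)] q b)
    then show ?thesis
      by (simp add: Inl dx_reduced distrib_left reduced_commute[of "b j" q])
  next
    case (Inr k)
    have "reduced q * (dyu (dy_t k) - mvar U2 * reduced (a k)) + mvar U2 * (reduced (a k) * reduced q)
        - dyu (dy_t k) * reduced q \<in> L"
      by (intro left_ideal_add[OF L(1)] left_ideal_diff[OF L(1)] left_ideal_mult[OF L(1)] q a)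
    moreover have "reduced q * (mvar U2 * reduced (a k)) = mvar U2 * (reduced (a k) * reduced q)"
      by (metis mvar_central mult.assoc reduced_commute)
    ultimately have "mvar U2 * reduced (mpderiv v q) \<in> L"
      by (simp add: Inr t_reduced right_diff_distrib)
    then have "mvar U1 * (mvar U2 * reduced (mpderiv v q))
        - reduced (mpderiv v q) * (mvar U1 * mvar U2 - 1) \<in> L"
      by (rule left_ideal_diff[OF L(1) left_ideal_mult[OF L(1)] left_ideal_mult[OF L(1)]])
        (rule subsetD[OF L(2) u_ideal_If])
    moreover have "mvar U1 * (mvar U2 * reduced (mpderiv v q)) = reduced (mpderiv v q) * (mvar U1 * mvar U2)"
      by (metis mvar_central mult.assoc)
    ultimately show ?thesis by (simp add: right_diff_distrib)
  qed
qed

text \<open>In degree zero, \<open>ideal_If f\<close> is as large as any proper left ideal above it: a nonzero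
  reduced element of \<open>L\<close> could be differentiated down to a nonzero constant in \<open>L\<close>. In
  \<open>degree_zero_annihilator\<close> below, \<open>L\<close> is the annihilator of a nonzero module element.\<close>

theorem degree_zero_mem_ideal_1:
  fixes f :: "'r::finite \<Rightarrow> 'n::{finite,linorder} cpoly"
  assumes P: "P \<in> dx_dt_t_subalgebra" "dyu P \<in> L"
    and L: "left_ideal L" "ideal_If f \<subseteq> L" "1 \<notin> L"
  shows "P \<in> ideal_1 f"
proof -
  obtain q where q: "dyu P - reduced q \<in> ideal_If f" using reduce_mod_ideal_If[OF P(1)] by blast
  from left_ideal_diff[OF L(1) P(2) subsetD[OF L(2) this]]
  have qL: "q \<in> {q. reduced q \<in> L}" by simp
  have "q = 0"
  proof (rule ccontr)
    assume "q \<noteq> 0"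
    then obtain c where c: "c \<noteq> 0" "reduced (Poly_Mapping.single 0 c) \<in> L"
      using derivation_closed_constant[OF _ qL] reduced_mpderiv_mem[OF L(1,2)] by auto
    then have "dyu (weyl_const (inverse c)) * dyu (weyl_const c) \<in> L"
      by (intro left_ideal_mult[OF L(1)]) (simp add: reduced_simps)
    then have "1 \<in> L"
      using c(1) by (simp add: mult_single flip: weyl_const_mult)
    with L show False by simp
  qed
  with q show ?thesis by (simp add: ideal_1_def reduced_simps)
qed

section \<open>Operators of degree zero\<close>

lemma dx_dt_t_subalgebra: "subalgebra dx_dt_t_subalgebra"
  unfolding dx_dt_t_subalgebra_def by (rule subalgebra_hull)

lemma degree_zero_intros:
  shows degree_zero_const: "weyl_const c \<in> dx_dt_t_subalgebra"
    and degree_zero_add: "P \<in> dx_dt_t_subalgebra \<Longrightarrow> Q \<in> dx_dt_t_subalgebra \<Longrightarrow> P + Q \<in> dx_dt_t_subalgebra"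
    and degree_zero_mult: "P \<in> dx_dt_t_subalgebra \<Longrightarrow> Q \<in> dx_dt_t_subalgebra \<Longrightarrow> P * Q \<in> dx_dt_t_subalgebra"
  using dx_dt_t_subalgebra by (auto simp: subalgebra_def)

lemma degree_zero_zero: "0 \<in> dx_dt_t_subalgebra"
  using degree_zero_const[of 0] by simp

lemma degree_zero_one: "1 \<in> dx_dt_t_subalgebra"
  using degree_zero_const[of 1] by simp

lemma degree_zero_uminus: "P \<in> dx_dt_t_subalgebra \<Longrightarrow> - P \<in> dx_dt_t_subalgebra"
  using degree_zero_mult[OF degree_zero_const[of "- 1"]] by (fastforce simp: weyl_const_uminus)

lemma degree_zero_sum: "(\<And>i. i \<in> S \<Longrightarrow> h i \<in> dx_dt_t_subalgebra) \<Longrightarrow> sum h S \<in> dx_dt_t_subalgebra"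
  by (induction S rule: infinite_finite_induct) (auto intro: degree_zero_zero degree_zero_add)

lemma degree_zero_power: "P \<in> dx_dt_t_subalgebra \<Longrightarrow> P ^ k \<in> dx_dt_t_subalgebra"
  by (induction k) (auto intro: degree_zero_one degree_zero_mult)

lemma degree_zero_x: "dy_x j \<in> dx_dt_t_subalgebra"
  unfolding dx_dt_t_subalgebra_def dx_subalgebra_def by (intro hull_inc UnI1) simp

lemma degree_zero_dx: "dy_dx j \<in> dx_dt_t_subalgebra"
  unfolding dx_dt_t_subalgebra_def dx_subalgebra_def
  by (rule hull_inc, rule UnI1, rule hull_inc, rule UnI2) (rule rangeI)

lemma degree_zero_dt_t: "dy_dt j * dy_t k \<in> dx_dt_t_subalgebra"
proof -
  have "- (dy_dt j * dy_t k) \<in> dx_dt_t_subalgebra"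
    unfolding dx_dt_t_subalgebra_def by (intro hull_inc) blast
  from degree_zero_uminus[OF this] show ?thesis by simp
qed

lemma degree_zero_t_dt: "(dy_t k * dy_dt j :: ('n, 'r) dy) \<in> dx_dt_t_subalgebra"
proof -
  have "dy_t k * dy_dt j = dy_dt j * dy_t k + (- weyl_const (if j = k then 1 else 0) :: ('n, 'r) dy)"
    by (auto simp: weyl_der_var)
  then show ?thesis
    using degree_zero_add[OF degree_zero_dt_t degree_zero_uminus[OF degree_zero_const]] by metis
qed

lemma degree_zero_dy_poly: "dy_poly (p :: 'n::{finite,linorder} cpoly) \<in> dx_dt_t_subalgebra"
proof (induction p rule: mult_induct_single)
  case zero
  show ?case by (simp add: dy_poly_zero degree_zero_zero)
qed (simp_all add: dy_poly_const dy_poly_mvar dy_poly_add dy_poly_mult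
       degree_zero_intros degree_zero_x)

lemma degree_zero_sigma: "dy_sigma \<in> dx_dt_t_subalgebra"
  unfolding dy_sigma_def by (intro degree_zero_uminus degree_zero_sum degree_zero_dt_t)

fun weight :: "('n + 'r) weyl_gen \<Rightarrow> int" where
  "weight (Var (Inl j)) = 0"
| "weight (Der (Inl j)) = 0"
| "weight (Var (Inr i)) = - 1"
| "weight (Der (Inr i)) = 1"

text \<open>So \<open>\<sigma> P = P (\<sigma> + d)\<close> for \<open>P\<close> of degree \<open>d\<close>: the operator that is \<open>\<sigma> - d\<close> in degree \<open>d\<close>
  commutes with the Weyl algebra.\<close>

lemma sigma_letter:
  "dy_sigma * weyl_letter a
    = weyl_letter a * dy_sigma + weyl_const (of_int (weight a)) * (weyl_letter a :: ('n, 'r::finite) dy)"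
proof -
  let ?\<theta> = "\<Sum>i\<in>UNIV. dy_dt i * dy_t i :: ('n, 'r) dy"
  have "?\<theta> * weyl_letter a = weyl_letter a * ?\<theta> - weyl_const (of_int (weight a)) * weyl_letter a"
  proof (cases a rule: weight.cases)
    case (1 j)
    have "dy_dt i * dy_t i * dy_x j = dy_x j * (dy_dt i * dy_t i)" for i :: 'r
    proof -
      have "dy_dt i * dy_x j = (dy_x j * dy_dt i :: ('n, 'r) dy)" by (simp add: weyl_der_var)
      moreover have "dy_t i * dy_x j = (dy_x j * dy_t i :: ('n, 'r) dy)" by (rule weyl_var_commute)
      ultimately show ?thesis by (metis mult.assoc)
    qed
    then show ?thesis by (simp add: 1 sum_distrib_left sum_distrib_right)
  next
    case (2 j)
    have "dy_dt i * dy_t i * dy_dx j = dy_dx j * (dy_dt i * dy_t i)" for i :: 'r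
    proof -
      have "dy_t i * dy_dx j = (dy_dx j * dy_t i :: ('n, 'r) dy)" by (simp add: weyl_der_var)
      moreover have "dy_dt i * dy_dx j = (dy_dx j * dy_dt i :: ('n, 'r) dy)" by (rule weyl_der_commute)
      ultimately show ?thesis by (metis mult.assoc)
    qed
    then show ?thesis by (simp add: 2 sum_distrib_left sum_distrib_right)
  next
    case (3 k)
    have "dy_dt i * dy_t i * dy_t k = dy_t k * (dy_dt i * dy_t i) + (if i = k then dy_t k else 0 :: ('n, 'r) dy)"
      for i :: 'r
    proof -
      have "dy_dt i * dy_t i * dy_t k = dy_dt i * dy_t k * (dy_t i :: ('n, 'r) dy)"
        by (simp add: mult.assoc weyl_var_commute)
      then show ?thesis by (simp add: weyl_der_var distrib_right mult.assoc)
    qed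
    then show ?thesis
      by (simp add: 3 sum_distrib_left sum_distrib_right sum.distrib weyl_const_uminus)
  next
    case (4 k)
    have "dy_dt i * dy_t i * dy_dt k = dy_dt k * (dy_dt i * dy_t i) - (if i = k then dy_dt k else 0 :: ('n, 'r) dy)"
      for i :: 'r
    proof -
      have "dy_t i * dy_dt k = dy_dt k * dy_t i - (if i = k then 1 else 0 :: ('n, 'r) dy)"
        by (simp add: weyl_der_var)
      then have "dy_dt i * dy_t i * dy_dt k
          = dy_dt i * dy_dt k * dy_t i - (if i = k then dy_dt i else 0 :: ('n, 'r) dy)"
        by (simp add: mult.assoc right_diff_distrib)
      then show ?thesis by (simp add: weyl_der_commute[of "Inr i"] mult.assoc)
    qed
    then show ?thesis
      by (simp add: 4 sum_distrib_left sum_distrib_right sum_subtractf)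
  qed
  then show ?thesis by (simp add: dy_sigma_def)
qed

section \<open>The graded module\<close>

text \<open>For a \<open>D\<^sub>Y\<close>-module \<open>N\<close>, the functions \<open>int \<Rightarrow> N\<close> are the (completed) module \<open>N[u, 1/u]\<close>, on
  which an operator of degree \<open>d\<close> on \<open>N\<close> also multiplies by \<open>u\<^sup>d\<close>. Here \<open>u\<^sub>1\<close> and \<open>u\<^sub>2\<close> act as \<open>u\<close> and
  its inverse, and \<open>s\<close> acts as \<open>\<sigma> - d\<close> in degree \<open>d\<close>. An element of \<open>N\<close> placed in degree zero is
  killed by \<open>s - \<sigma>\<close>.\<close>

locale dy_module = weyl_ops scale op
  for scale :: "complex \<Rightarrow> 'm::ab_group_add \<Rightarrow> 'm" and op :: "('n::{finite,linorder} + 'r::finite) weyl_gen \<Rightarrow> 'm \<Rightarrow> 'm"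
begin

abbreviation act :: "('n, 'r) dy \<Rightarrow> 'm \<Rightarrow> 'm" where "act \<equiv> weyl_act scale op"

sublocale ring_action act by (rule ring_action_weyl_act)

definition gr_scale :: "complex \<Rightarrow> (int \<Rightarrow> 'm) \<Rightarrow> int \<Rightarrow> 'm" where
  "gr_scale c v d = scale c (v d)"

definition gr_op :: "('n + 'r) weyl_gen \<Rightarrow> (int \<Rightarrow> 'm) \<Rightarrow> int \<Rightarrow> 'm" where
  "gr_op a v d = op a (v (d - weight a))"

lemma weyl_ops_gr: "weyl_ops gr_scale gr_op"
proof
  fix a b :: complex and x y :: "int \<Rightarrow> 'm"
  show "gr_scale a (x + y) = gr_scale a x + gr_scale a y"
    by (rule ext) (simp add: gr_scale_def scale_right_distrib)
  show "gr_scale (a + b) x = gr_scale a x + gr_scale b x"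
    by (rule ext) (simp add: gr_scale_def scale_left_distrib)
  show "gr_scale a (gr_scale b x) = gr_scale (a * b) x"
    by (rule ext) (simp add: gr_scale_def)
  show "gr_scale 1 x = x"
    by (rule ext) (simp add: gr_scale_def)
next
  fix a c and x y :: "int \<Rightarrow> 'm"
  show "gr_op a (x + y) = gr_op a x + gr_op a y"
    by (rule ext) (simp add: gr_op_def op_add)
  show "gr_op a (gr_scale c x) = gr_scale c (gr_op a x)"
    by (rule ext) (simp add: gr_op_def gr_scale_def op_scale)
next
  fix v w and x :: "int \<Rightarrow> 'm"
  show "gr_op (Var v) (gr_op (Var w) x) = gr_op (Var w) (gr_op (Var v) x)"
  proof (rule ext)
    fix d
    have "d - weight (Var v) - weight (Var w) = d - weight (Var w) - weight (Var v)" by simp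
    then show "gr_op (Var v) (gr_op (Var w) x) d = gr_op (Var w) (gr_op (Var v) x) d"
      unfolding gr_op_def by (simp only: op_Var_Var)
  qed
  show "gr_op (Der v) (gr_op (Der w) x) = gr_op (Der w) (gr_op (Der v) x)"
  proof (rule ext)
    fix d
    have "d - weight (Der v) - weight (Der w) = d - weight (Der w) - weight (Der v)" by simp
    then show "gr_op (Der v) (gr_op (Der w) x) d = gr_op (Der w) (gr_op (Der v) x) d"
      unfolding gr_op_def by (metis op_Der_Der)
  qed
  show "gr_op (Der v) (gr_op (Var w) x) = gr_op (Var w) (gr_op (Der v) x) + (if v = w then x else 0)"
  proof (rule ext)
    fix d
    have e: "d - weight (Der v) - weight (Var w) = d - weight (Var w) - weight (Der v)" by simp
    have w: "d - weight (Var w) - weight (Der w) = d" "d - weight (Der w) - weight (Var w) = d"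
      by (cases w; simp)+
    show "gr_op (Der v) (gr_op (Var w) x) d
        = (gr_op (Var w) (gr_op (Der v) x) + (if v = w then x else 0)) d"
    proof (cases "v = w")
      case True
      then show ?thesis by (simp only: gr_op_def op_Der_Var plus_fun_apply w if_True simp_thms)
    next
      case False
      then show ?thesis by (simp only: gr_op_def op_Der_Var plus_fun_apply e if_False zero_fun_apply)
    qed
  qed
qed

abbreviation gr_act :: "('n, 'r) dy \<Rightarrow> (int \<Rightarrow> 'm) \<Rightarrow> int \<Rightarrow> 'm" where
  "gr_act \<equiv> weyl_act gr_scale gr_op"

interpretation gr: weyl_ops gr_scale gr_op by (rule weyl_ops_gr)
interpretation gr: ring_action gr_act by (rule gr.ring_action_weyl_act)

lemma gr_act_degree_zero:
  assumes "P \<in> dx_dt_t_subalgebra" shows "gr_act P v d = act P (v d)"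
proof -
  have "dx_dt_t_subalgebra \<subseteq> {P. \<forall>v d. gr_act P v d = act P (v d)}"
  proof (rule dx_dt_t_subalgebra_subset)
    show "subalgebra {P. \<forall>v d. gr_act P v d = act P (v d)}"
      by (auto simp: subalgebra_def gr.weyl_act_const weyl_act_const gr_scale_def
          gr.add_left add_left gr.mult mult)
  qed (auto simp: gr.weyl_act_var weyl_act_var gr.weyl_act_der weyl_act_der gr_op_def
      gr.mult mult gr.uminus_left uminus_left)
  with assms show ?thesis by blast
qed

definition u_shift :: "(uvar \<Rightarrow>\<^sub>0 nat) \<Rightarrow> (int \<Rightarrow> 'm) \<Rightarrow> int \<Rightarrow> 'm" where
  "u_shift m v d = v (d - int (Poly_Mapping.lookup m U1) + int (Poly_Mapping.lookup m U2))"

lemma monoid_ring_action_u: "monoid_ring_action gr_act u_shift"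
proof
  fix m k :: "uvar \<Rightarrow>\<^sub>0 nat" and x y :: "int \<Rightarrow> 'm" and P
  show "u_shift 0 x = x" by (rule ext) (simp add: u_shift_def)
  show "u_shift (m + k) x = u_shift m (u_shift k x)"
    by (rule ext) (simp add: u_shift_def lookup_add algebra_simps)
  show add: "u_shift m (x + y) = u_shift m x + u_shift m y" for x y
    by (rule ext) (simp add: u_shift_def)
  show "u_shift m (gr_act P x) = gr_act P (u_shift m x)"
    by (rule gr.weyl_act_endo)
       (auto simp: add u_shift_def gr_scale_def gr_op_def fun_eq_iff algebra_simps)
qed

definition s_op :: "(int \<Rightarrow> 'm) \<Rightarrow> int \<Rightarrow> 'm" where
  "s_op v d = act dy_sigma (v d) - scale (of_int d) (v d)"

lemma s_op_add: "s_op (x + y) = s_op x + s_op y"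
  by (rule ext) (simp add: s_op_def add_right scale_right_distrib)

lemma s_op_gr_act: "s_op (gr_act P x) = gr_act P (s_op x)"
proof (rule gr.weyl_act_endo)
  show "s_op (gr_scale c x) = gr_scale c (s_op x)" for c x
  proof (rule ext)
    fix d
    have "act dy_sigma (scale c (x d)) = scale c (act dy_sigma (x d))"
      by (metis mult weyl_act_const weyl_const_commute)
    then show "s_op (gr_scale c x) d = gr_scale c (s_op x) d"
      by (simp add: s_op_def gr_scale_def scale_right_diff_distrib mult.commute)
  qed
  show "s_op (gr_op a x) = gr_op a (s_op x)" for a x
  proof (rule ext)
    fix d
    let ?y = "x (d - weight a)"
    have "act dy_sigma (op a ?y) = op a (act dy_sigma ?y) + scale (of_int (weight a)) (op a ?y)"
      using arg_cong[OF sigma_letter[of a], of "\<lambda>P. act P ?y"]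
      by (simp add: add_left mult weyl_act_const weyl_act_letter)
    moreover have "op a (act dy_sigma ?y - scale (of_int (d - weight a)) ?y)
        = op a (act dy_sigma ?y) - scale (of_int (d - weight a)) (op a ?y)"
      using diff_right[of "weyl_letter a"] by (simp add: weyl_act_letter op_scale)
    ultimately show "s_op (gr_op a x) d = gr_op a (s_op x) d"
      by (simp add: s_op_def gr_op_def scale_left_diff_distrib)
  qed
qed (rule s_op_add)

lemma monoid_ring_action_s: "monoid_ring_action gr_act (\<lambda>k. s_op ^^ k)"
proof
  fix k l :: nat and x y :: "int \<Rightarrow> 'm" and P
  show "(s_op ^^ k) (x + y) = (s_op ^^ k) x + (s_op ^^ k) y"
    by (induction k) (simp_all only: funpow.simps id_apply o_apply s_op_add)
  show "(s_op ^^ k) (gr_act P x) = gr_act P ((s_op ^^ k) x)"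
    by (induction k) (simp_all add: s_op_gr_act)
qed (simp_all add: funpow_add)

interpretation u: monoid_ring_action gr_act u_shift by (rule monoid_ring_action_u)
interpretation u: ring_action u.pact by (rule u.ring_action_pact)
interpretation s: monoid_ring_action gr_act "\<lambda>k. s_op ^^ k" by (rule monoid_ring_action_s)
interpretation s: ring_action s.pact by (rule s.ring_action_pact)

definition deg0 :: "'m \<Rightarrow> int \<Rightarrow> 'm" where
  "deg0 x d = (if d = 0 then x else 0)"

lemma deg0_gr_act: "P \<in> dx_dt_t_subalgebra \<Longrightarrow> gr_act P (deg0 x) = deg0 (act P x)"
  by (rule ext) (simp add: gr_act_degree_zero deg0_def)

lemma deg0_s_op: "(s_op ^^ k) (deg0 x) = deg0 (act (dy_sigma ^ k) x)"
proof (induction k)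
  case (Suc k)
  have "s_op (deg0 y) = deg0 (act dy_sigma y)" for y
    by (rule ext) (simp add: s_op_def deg0_def)
  then show ?case using Suc by (simp add: mult)
qed (simp add: one)

lemma u_pact_dyu: "u.pact (dyu P) v = gr_act P v"
  using u.pact_single[of 0] by (simp add: u.tau_zero)

lemma u_pact_mvar: "u.pact (mvar w) v = u_shift (Poly_Mapping.single w 1) v"
  by (simp only: mvar_def u.pact_single gr.one)

text \<open>Given a subspace \<open>W\<close> of \<open>N\<close> that is stable under the operators of degree zero, the sets
  \<open>gr_component W d\<close> defined below are the components of a submodule of the graded module whose
  component of degree zero is \<open>W\<close>: an element of positive degree belongs to it if all products
  of \<open>t\<^sub>i\<close> that bring it back to degree zero map it into \<open>W\<close>, and likewise for negative degree
  and the \<open>\<partial>\<^bsub>t i\<^esub>\<close>. This is the largest such submodule. Its definition refers only to the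
  action on \<open>N\<close>, whereas the submodule generated by \<open>W\<close> would have to be described by
  decompositions of operators into homogeneous components.\<close>

primrec pull :: "('r \<Rightarrow> ('n, 'r) dy) \<Rightarrow> 'm set \<Rightarrow> nat \<Rightarrow> 'm set" where
  "pull y W 0 = W"
| "pull y W (Suc k) = {x. \<forall>i. act (y i) x \<in> pull y W k}"

text \<open>The last assumption holds for \<open>t\<^sub>i\<close> and for \<open>\<partial>\<^bsub>t i\<^esub>\<close>: moving them past \<open>\<partial>\<^bsub>t j\<^esub> t\<^sub>k\<close> leaves a multiple of
  \<open>t\<^sub>k\<close> or of \<open>\<partial>\<^bsub>t j\<^esub>\<close>, which lowers the index of \<open>pull\<close> as well.\<close>

lemma stable_pull:
  assumes W: "stable_under dx_dt_t_subalgebra W"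
    and y_x: "\<And>i j. y i * dy_x j = dy_x j * y i" and y_dx: "\<And>i j. y i * dy_dx j = dy_dx j * y i"
    and y_dt_t: "\<And>i j k. \<exists>c l. y i * (dy_dt j * dy_t k) = dy_dt j * dy_t k * y i + weyl_const c * y l"
  shows "stable_under dx_dt_t_subalgebra (pull y W k)"
proof (induction k)
  case 0
  show ?case using W by simp
next
  case (Suc n)
  let ?V = "pull y W n"
  have V0: "0 \<in> ?V" and Vadd: "\<And>x z. x \<in> ?V \<Longrightarrow> z \<in> ?V \<Longrightarrow> x + z \<in> ?V"
    and VA: "\<And>P x. P \<in> dx_dt_t_subalgebra \<Longrightarrow> x \<in> ?V \<Longrightarrow> act P x \<in> ?V"
    using Suc by (auto simp: stable_under_def)
  have Vc: "act (weyl_const c) x \<in> ?V" if "x \<in> ?V" for c x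
    by (rule VA[OF degree_zero_const that])
  let ?S = "{P. \<forall>x\<in>pull y W (Suc n). act P x \<in> pull y W (Suc n)}"
  have "dx_dt_t_subalgebra \<subseteq> ?S"
  proof (rule dx_dt_t_subalgebra_subset)
    have c: "act (y i) (act (weyl_const c) x) = act (weyl_const c) (act (y i) x)" for i c x
      by (metis mult weyl_const_commute)
    have "act (weyl_const a) x \<in> pull y W (Suc n)" if "x \<in> pull y W (Suc n)" for a x
      using that by (simp add: c Vc)
    then show "subalgebra ?S"
      by (auto simp: subalgebra_def add_left add_right mult intro: Vadd)
    have "act (y i) (act (dy_x j) x) = act (dy_x j) (act (y i) x)" for i j x
      by (metis mult y_x)
    then show "range dy_x \<subseteq> ?S" by (auto simp: VA degree_zero_x)
    have "act (y i) (act (dy_dx j) x) = act (dy_dx j) (act (y i) x)" for i j x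
      by (metis mult y_dx)
    then show "range dy_dx \<subseteq> ?S" by (auto simp: VA degree_zero_dx)
    show "- (dy_dt j * dy_t k) \<in> ?S" for j k
    proof (intro CollectI ballI, unfold pull.simps, intro CollectI allI)
      fix x i assume x: "x \<in> {x. \<forall>i. act (y i) x \<in> pull y W n}"
      obtain c l where cl: "y i * (dy_dt j * dy_t k) = dy_dt j * dy_t k * y i + weyl_const c * y l"
        using y_dt_t by blast
      have "y i * (- (dy_dt j * dy_t k)) = - (dy_dt j * dy_t k) * y i + weyl_const (- c) * y l"
        by (simp add: cl weyl_const_uminus)
      then have "act (y i) (act (- (dy_dt j * dy_t k)) x)
          = act (- (dy_dt j * dy_t k)) (act (y i) x) + act (weyl_const (- c)) (act (y l) x)"
        by (metis mult add_left)
      also have "\<dots> \<in> ?V"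
        using x by (intro Vadd VA[OF degree_zero_uminus[OF degree_zero_dt_t]] Vc) auto
      finally show "act (y i) (act (- (dy_dt j * dy_t k)) x) \<in> ?V" .
    qed
  qed
  then show ?case by (auto simp: stable_under_def add_right V0 Vadd)
qed

definition gr_component :: "'m set \<Rightarrow> int \<Rightarrow> 'm set" where
  "gr_component W d = (if 0 \<le> d then pull dy_t W (nat d) else pull dy_dt W (nat (- d)))"

lemma stable_gr_component:
  assumes "stable_under dx_dt_t_subalgebra W"
  shows "stable_under dx_dt_t_subalgebra (gr_component W d)"
proof -
  have "stable_under dx_dt_t_subalgebra (pull dy_t W k)" for k
  proof (rule stable_pull[OF assms])
    show "dy_t i * dy_x j = dy_x j * dy_t i" for i :: 'r and j :: 'n by (rule weyl_var_commute)
    show "dy_t i * dy_dx j = dy_dx j * dy_t i" for i :: 'r and j :: 'n by (simp add: weyl_der_var)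
    show "\<exists>c l. dy_t i * (dy_dt j * dy_t k) = dy_dt j * dy_t k * dy_t i + weyl_const c * (dy_t l :: ('n, 'r) dy)"
      for i j k
    proof (intro exI)
      have "dy_t i * dy_dt j = (dy_dt j * dy_t i + weyl_const (if j = i then - 1 else 0) :: ('n, 'r) dy)"
        by (auto simp: weyl_der_var weyl_const_uminus)
      then have "dy_t i * dy_dt j * dy_t k
          = dy_dt j * (dy_t i * dy_t k) + weyl_const (if j = i then - 1 else 0) * (dy_t k :: ('n, 'r) dy)"
        by (simp add: distrib_right mult.assoc)
      then show "dy_t i * (dy_dt j * dy_t k)
          = dy_dt j * dy_t k * dy_t i + weyl_const (if j = i then - 1 else 0) * (dy_t k :: ('n, 'r) dy)"
        by (simp add: mult.assoc weyl_var_commute[of "Inr i"])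
    qed
  qed
  moreover have "stable_under dx_dt_t_subalgebra (pull dy_dt W k)" for k
  proof (rule stable_pull[OF assms])
    show "dy_dt i * dy_x j = dy_x j * dy_dt i" for i :: 'r and j :: 'n by (simp add: weyl_der_var)
    show "dy_dt i * dy_dx j = dy_dx j * dy_dt i" for i :: 'r and j :: 'n by (rule weyl_der_commute)
    show "\<exists>c l. dy_dt i * (dy_dt j * dy_t k) = dy_dt j * dy_t k * dy_dt i + weyl_const c * (dy_dt l :: ('n, 'r) dy)"
      for i j k
    proof (intro exI)
      have "dy_dt i * (dy_dt j * dy_t k) = dy_dt j * (dy_dt i * dy_t k :: ('n, 'r) dy)"
        using weyl_der_commute[of "Inr i" "Inr j"] by (metis mult.assoc)
      also have "\<dots> = dy_dt j * (dy_t k * dy_dt i + weyl_const (if i = k then 1 else 0))"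
        by (simp add: weyl_der_var)
      finally show "dy_dt i * (dy_dt j * dy_t k)
          = dy_dt j * dy_t k * dy_dt i + weyl_const (if i = k then 1 else 0) * (dy_dt j :: ('n, 'r) dy)"
        by (simp add: distrib_left mult.assoc weyl_const_commute)
    qed
  qed
  ultimately show ?thesis by (simp add: gr_component_def)
qed

text \<open>Towards degree zero this is the definition of \<open>pull\<close>. Away from degree zero, the operator
  is followed by one of opposite degree, and the product of the two has degree zero.\<close>

lemma op_gr_component:
  assumes W: "stable_under dx_dt_t_subalgebra W" and x: "x \<in> gr_component W d"
  shows "op a x \<in> gr_component W (d + weight a)"
proof -
  have A: "act P z \<in> gr_component W e" if "P \<in> dx_dt_t_subalgebra" "z \<in> gr_component W e" for P z e
    using stable_gr_component[OF W, of e] that by (auto simp: stable_under_def)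
  show ?thesis
  proof (cases a rule: weight.cases)
    case (1 j)
    then show ?thesis using A[OF degree_zero_x x] by (simp add: weyl_act_var)
  next
    case (2 j)
    then show ?thesis using A[OF degree_zero_dx x] by (simp add: weyl_act_der)
  next
    case (3 i)
    show ?thesis
    proof (cases "0 < d")
      case True
      then have "nat d = Suc (nat (d - 1))" by simp
      then show ?thesis using x True by (simp add: 3 gr_component_def weyl_act_var)
    next
      case False
      then have n: "nat (- (d - 1)) = Suc (nat (- d))" by simp
      have "act (dy_dt j) (op a x) \<in> gr_component W d" for j
        using A[OF degree_zero_dt_t[of j i] x] by (simp add: 3 mult weyl_act_var)
      then have "act (dy_dt j) (op a x) \<in> pull dy_dt W (nat (- d))" for j
        using False by (cases "d = 0") (auto simp: gr_component_def)
      then show ?thesis using False n by (simp add: 3 gr_component_def)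
    qed
  next
    case (4 i)
    show ?thesis
    proof (cases "0 \<le> d")
      case True
      then have n: "nat (d + 1) = Suc (nat d)" by simp
      have "act (dy_t j) (op a x) \<in> gr_component W d" for j
        using A[OF degree_zero_t_dt[of j i] x] by (simp add: 4 mult weyl_act_der)
      then show ?thesis using True n by (simp add: 4 gr_component_def)
    next
      case False
      then have "nat (- d) = Suc (nat (- (d + 1)))" by simp
      then have "op a x \<in> pull dy_dt W (nat (- (d + 1)))"
        using x False by (simp add: 4 gr_component_def weyl_act_der)
      then show ?thesis using False by (cases "d = - 1") (auto simp: 4 gr_component_def)
    qed
  qed
qed

lemma stable_graded:
  assumes W: "stable_under dx_dt_t_subalgebra W"
  shows "s.stable_under UNIV {v. \<forall>d. v d \<in> gr_component W d}"
proof -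
  let ?K = "{v. \<forall>d. v d \<in> gr_component W d}"
  have V0: "0 \<in> gr_component W d"
    and Vadd: "x \<in> gr_component W d \<Longrightarrow> y \<in> gr_component W d \<Longrightarrow> x + y \<in> gr_component W d"
    and VA: "P \<in> dx_dt_t_subalgebra \<Longrightarrow> x \<in> gr_component W d \<Longrightarrow> act P x \<in> gr_component W d" for d x y P
    using stable_gr_component[OF W, of d] by (auto simp: stable_under_def)
  have Vscale: "x \<in> gr_component W d \<Longrightarrow> scale c x \<in> gr_component W d" for x c d
    using VA[OF degree_zero_const] by (simp add: weyl_act_const)
  have Kadd: "x + y \<in> ?K" if "x \<in> ?K" "y \<in> ?K" for x y using that Vadd by auto
  have K_gr: "gr_act P v \<in> ?K" if "v \<in> ?K" for P v
  proof (rule gr.weyl_act_mem)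
    show "gr_op a v \<in> ?K" if "v \<in> ?K" for a v
    proof (intro CollectI allI)
      fix d
      have "op a (v (d - weight a)) \<in> gr_component W (d - weight a + weight a)"
        by (rule op_gr_component[OF W]) (use that in auto)
      then show "gr_op a v d \<in> gr_component W d" by (simp add: gr_op_def)
    qed
  qed (use that V0 Vscale Kadd in \<open>auto simp: gr_scale_def\<close>)
  have "s_op v \<in> ?K" if "v \<in> ?K" for v
  proof (intro CollectI allI)
    fix d
    have "act dy_sigma (v d) + scale (- of_int d) (v d) \<in> gr_component W d"
      using that by (intro Vadd VA Vscale degree_zero_sigma) auto
    then show "s_op v d \<in> gr_component W d" by (simp add: s_op_def)
  qed
  then have K_s: "(s_op ^^ k) v \<in> ?K" if "v \<in> ?K" for k v
    using that by (induction k) auto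
  have K_sum: "(\<And>i. i \<in> S \<Longrightarrow> h i \<in> ?K) \<Longrightarrow> sum h S \<in> ?K" for h and S :: "nat set"
    by (induction S rule: infinite_finite_induct) (use V0 Kadd in auto)
  have "s.pact p v \<in> ?K" if "v \<in> ?K" for p v
    unfolding s.pact_def by (intro K_sum K_gr K_s that)
  then show ?thesis
    unfolding s.stable_under_def using V0 Kadd by auto
qed

text \<open>The two assumptions on \<open>e\<close> say that it satisfies the defining relations of \<open>\<Prod>\<^sub>i f\<^sub>i^s\<^sub>i\<close>. In the
  graded module the powers of \<open>u\<^sub>1\<close> in the generators of \<open>ideal_If f\<close> make up for the different
  degrees of their terms, so that these generators kill \<open>e\<close> placed in degree zero.\<close>

context
  fixes f :: "'r \<Rightarrow> 'n cpoly" and e :: 'm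
  assumes t_e: "\<And>i. act (dy_t i) e = act (dy_poly (f i)) e"
    and dx_e: "\<And>j. act (dy_dx j) e + (\<Sum>i\<in>UNIV. act (dy_poly (mpderiv j (f i)) * dy_dt i) e) = 0"
begin

lemma ideal_If_annihilates: "ideal_If f \<subseteq> {p. u.pact p (deg0 e) = 0}"
proof -
  let ?L = "{p. u.pact p (deg0 e) = 0}"
  have L: "left_ideal ?L" by (rule u.left_ideal_annihilator)
  have "left_ideal hull (range (\<lambda>i. dyu (dy_t i) * mvar U1 - dyu (dy_poly (f i)))) \<subseteq> ?L"
  proof (rule hull_minimal[of _ ?L left_ideal, OF _ L], intro subsetI CollectI)
    fix p :: "('n, 'r) dy_u" assume "p \<in> range (\<lambda>i. dyu (dy_t i) * mvar U1 - dyu (dy_poly (f i)))"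
    then obtain i where p: "p = dyu (dy_t i) * mvar U1 - dyu (dy_poly (f i))" by blast
    show "u.pact p (deg0 e) = 0"
    proof (rule ext)
      fix d
      have "gr_act (dy_t i) (u_shift (Poly_Mapping.single U1 1) (deg0 e)) d = act (dy_t i) (deg0 e d)"
        by (simp add: gr.weyl_act_var weyl_act_var gr_op_def u_shift_def lookup_single)
      then show "u.pact p (deg0 e) d = 0 d"
        using t_e[of i]
        by (simp add: p u.diff_left u.mult u_pact_dyu u_pact_mvar gr_act_degree_zero
            degree_zero_dy_poly deg0_def)
    qed
  qed
  moreover have "left_ideal hull (range (\<lambda>j. mvar U1 * dyu (dy_dx j)
      + (\<Sum>i\<in>UNIV. dyu (dy_poly (mpderiv j (f i)) * dy_dt i)))) \<subseteq> ?L"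
  proof (rule hull_minimal[of _ ?L left_ideal, OF _ L], intro subsetI CollectI)
    fix p :: "('n, 'r) dy_u"
    assume "p \<in> range (\<lambda>j. mvar U1 * dyu (dy_dx j)
      + (\<Sum>i\<in>UNIV. dyu (dy_poly (mpderiv j (f i)) * dy_dt i)))"
    then obtain j where p: "p = mvar U1 * dyu (dy_dx j)
      + (\<Sum>i\<in>UNIV. dyu (dy_poly (mpderiv j (f i)) * dy_dt i))" by blast
    show "u.pact p (deg0 e) = 0"
    proof (rule ext)
      fix d
      have "u_shift (Poly_Mapping.single U1 1) (gr_act (dy_dx j) (deg0 e)) d
          = act (dy_dx j) (deg0 e (d - 1))"
        by (simp add: gr.weyl_act_der weyl_act_der gr_op_def u_shift_def lookup_single)
      moreover have "gr_act (dy_poly q * dy_dt i) (deg0 e) d = act (dy_poly q * dy_dt i) (deg0 e (d - 1))" for q i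
        by (simp add: gr.mult mult gr_act_degree_zero degree_zero_dy_poly gr.weyl_act_der weyl_act_der gr_op_def)
      moreover have "sum h S d = (\<Sum>i\<in>S. h i d)" for h :: "'r \<Rightarrow> int \<Rightarrow> 'm" and S
        by (induction S rule: infinite_finite_induct) auto
      ultimately show "u.pact p (deg0 e) d = 0 d"
        using dx_e[of j]
        by (simp add: p u.add_left u.sum_left u.mult u_pact_dyu u_pact_mvar deg0_def)
    qed
  qed
  moreover have "left_ideal hull {mvar U1 * mvar U2 - 1} \<subseteq> ?L"
  proof (rule hull_minimal[of _ ?L left_ideal, OF _ L], clarify)
    show "u.pact (mvar U1 * mvar U2 - 1) (deg0 e) = 0"
      by (rule ext) (simp add: u.diff_left u.mult u.one u_pact_mvar u_shift_def lookup_single)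
  qed
  ultimately show ?thesis
    unfolding ideal_If_def by (intro left_ideal_plus_least[OF L])
qed

lemma ideal_1_annihilates: "P \<in> ideal_1 f \<Longrightarrow> gr_act P (deg0 e) = 0"
  using ideal_If_annihilates by (auto simp: ideal_1_def u_pact_dyu)

lemma degree_zero_annihilator:
  assumes "e \<noteq> 0" "P \<in> dx_dt_t_subalgebra" "act P e = 0"
  shows "P \<in> ideal_1 f"
proof (rule degree_zero_mem_ideal_1)
  let ?L = "{p. u.pact p (deg0 e) = 0}"
  show "ideal_If f \<subseteq> ?L" by (rule ideal_If_annihilates)
  show "left_ideal ?L" by (rule u.left_ideal_annihilator)
  show "dyu P \<in> ?L"
    using assms by (auto simp: u_pact_dyu deg0_gr_act deg0_def)
  have "deg0 e 0 \<noteq> 0" using assms by (simp add: deg0_def)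
  then show "1 \<notin> ?L" by (auto simp: u.one)
qed fact

text \<open>Each of the three kinds of generators maps \<open>deg0 e\<close> into the graded submodule with component
  \<open>W\<close> in degree zero, and so do their left multiples. In degree zero \<open>s\<close> acts as \<open>\<sigma>\<close>, and there
  this membership is the conclusion.\<close>

lemma eval_at_sigma_mem:
  fixes g :: "'n cpoly"
  assumes "dys_poly h \<in> left_ideal hull
     (dys ` ideal_1 f \<union> (\<lambda>a. dys (dy_poly (g * a))) ` (left_ideal hull (range f))
      \<union> {Poly_Mapping.single 1 1 - dys dy_sigma})"
  shows "\<exists>P. (\<forall>j. P j \<in> dx_dt_t_subalgebra) \<and>
    (\<Sum>k\<le>degree h. act (dy_poly (coeff h k) * dy_sigma ^ k) e)
      = (\<Sum>j\<in>UNIV. act (P j * dy_poly (g * f j)) e)"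
proof -
  define W where "W = {x. \<exists>P. (\<forall>j. P j \<in> dx_dt_t_subalgebra) \<and>
    x = (\<Sum>j\<in>UNIV. act (P j * dy_poly (g * f j)) e)}"
  have Wadd: "x + y \<in> W" if "x \<in> W" "y \<in> W" for x y
  proof -
    from that obtain P Q where "\<forall>j. P j \<in> dx_dt_t_subalgebra" "\<forall>j. Q j \<in> dx_dt_t_subalgebra"
      "x = (\<Sum>j\<in>UNIV. act (P j * dy_poly (g * f j)) e)" "y = (\<Sum>j\<in>UNIV. act (Q j * dy_poly (g * f j)) e)"
      by (auto simp: W_def)
    then show ?thesis
      unfolding W_def
      by (intro CollectI exI[of _ "\<lambda>j. P j + Q j"])
        (simp add: degree_zero_add distrib_right add_left sum.distrib)
  qed
  have WA: "act Q x \<in> W" if "Q \<in> dx_dt_t_subalgebra" "x \<in> W" for Q x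
  proof -
    from that(2) obtain P where "\<forall>j. P j \<in> dx_dt_t_subalgebra"
      "x = (\<Sum>j\<in>UNIV. act (P j * dy_poly (g * f j)) e)" by (auto simp: W_def)
    then show ?thesis
      unfolding W_def using that(1)
      by (intro CollectI exI[of _ "\<lambda>j. Q * P j"]) (simp add: degree_zero_mult sum_right mult)
  qed
  have W0: "0 \<in> W"
    unfolding W_def by (intro CollectI exI[of _ "\<lambda>j. 0"]) (simp add: degree_zero_zero)
  have Wf: "act (dy_poly (g * f i)) e \<in> W" for i
  proof -
    have "(\<Sum>j\<in>UNIV. act ((if j = i then 1 else 0) * dy_poly (g * f j)) e)
        = (\<Sum>j\<in>UNIV. if j = i then act (dy_poly (g * f j)) e else 0)"
      by (rule sum.cong) auto
    then show ?thesis
      unfolding W_def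
      by (intro CollectI exI[of _ "\<lambda>j. if j = i then 1 else 0"])
        (simp add: degree_zero_zero degree_zero_one)
  qed
  have "left_ideal hull (range f) \<subseteq> {a. act (dy_poly (g * a)) e \<in> W}"
  proof (rule hull_minimal)
    have "act (dy_poly (g * (c * a))) e = act (dy_poly c) (act (dy_poly (g * a)) e)" for c a
      by (metis dy_poly_mult mult mult.left_commute)
    then show "left_ideal {a. act (dy_poly (g * a)) e \<in> W}"
      by (auto simp: left_ideal_def distrib_left dy_poly_add add_left dy_poly_zero W0 Wadd
          WA degree_zero_dy_poly)
  qed (use Wf in auto)
  then have Wa: "act (dy_poly (g * a)) e \<in> W" if "a \<in> left_ideal hull (range f)" for a
    using that by blast
  have W: "stable_under dx_dt_t_subalgebra W"
    unfolding stable_under_def using W0 Wadd WA by blast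
  let ?K = "{v. \<forall>d. v d \<in> gr_component W d}"
  have s_dys: "s.pact (dys P) v = gr_act P v" for P v
    using s.pact_single[of 0] by simp
  have "s.pact (dys_poly h) (deg0 e) \<in> ?K"
  proof (rule s.hull_act_mem[OF stable_graded[OF W] _ assms])
    have K0: "0 \<in> ?K" using stable_graded[OF W] by (simp add: s.stable_under_def)
    fix p :: "nat \<Rightarrow>\<^sub>0 ('n, 'r) dy"
    assume "p \<in> dys ` ideal_1 f \<union> (\<lambda>a. dys (dy_poly (g * a))) ` (left_ideal hull (range f))
      \<union> {Poly_Mapping.single 1 1 - dys dy_sigma}"
    then consider P where "p = dys P" "P \<in> ideal_1 f"
      | a where "p = dys (dy_poly (g * a))" "a \<in> left_ideal hull (range f)"
      | "p = Poly_Mapping.single 1 1 - dys dy_sigma" by blast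
    then show "s.pact p (deg0 e) \<in> ?K"
    proof cases
      case 1
      then show ?thesis using K0 by (simp add: s_dys ideal_1_annihilates)
    next
      case 2
      have "deg0 (act (dy_poly (g * a)) e) d \<in> gr_component W d" for d
      proof (cases "d = 0")
        case True
        then show ?thesis using Wa[OF 2(2)] by (simp add: deg0_def gr_component_def)
      next
        case False
        then show ?thesis using K0 by (simp add: deg0_def)
      qed
      then show ?thesis by (simp add: 2 s_dys deg0_gr_act degree_zero_dy_poly)
    next
      case 3
      have "s.pact p (deg0 e) = s_op (deg0 e) - gr_act dy_sigma (deg0 e)"
        by (simp add: 3 s.diff_left s_dys s.pact_single gr.one)
      also have "\<dots> = 0"
        using deg0_s_op[of 1 e] by (simp add: deg0_gr_act degree_zero_sigma)
      finally show ?thesis using K0 by simp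
    qed
  qed
  then have "s.pact (dys_poly h) (deg0 e) 0 \<in> W"
    by (auto simp: gr_component_def dest: spec[of _ 0])
  moreover have "s.pact (dys_poly h) (deg0 e) 0 = (\<Sum>k\<le>degree h. act (dy_poly (coeff h k) * dy_sigma ^ k) e)"
  proof -
    have "s.pact (dys_poly h) (deg0 e) = (\<Sum>k\<le>degree h. deg0 (act (dy_poly (coeff h k) * dy_sigma ^ k) e))"
      by (simp add: dys_poly_def s.sum_left s.pact_single deg0_s_op deg0_gr_act degree_zero_dy_poly mult)
    moreover have "sum q S d = (\<Sum>i\<in>S. q i d)" for q :: "nat \<Rightarrow> int \<Rightarrow> 'm" and S d
      by (induction S rule: infinite_finite_induct) auto
    ultimately show ?thesis by (simp add: deg0_def)
  qed
  ultimately show ?thesis by (auto simp: W_def)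
qed

end

end

section \<open>Ideals of univariate polynomials\<close>

lemma mem_hull_singleton:
  fixes b :: "'a::comm_ring_1"
  shows "c \<in> left_ideal hull {b} \<longleftrightarrow> b dvd c"
proof
  have "left_ideal {c. b dvd c}" by (auto simp: left_ideal_def)
  then have "left_ideal hull {b} \<subseteq> {c. b dvd c}" by (intro hull_minimal) auto
  then show "c \<in> left_ideal hull {b} \<Longrightarrow> b dvd c" by blast
next
  assume "b dvd c"
  then obtain q where "c = q * b" by (metis dvdE mult.commute)
  then show "c \<in> left_ideal hull {b}"
    using left_ideal_mult[OF left_ideal_hull hull_inc[of b "{b}"]] by auto
qed

lemma minimal_monic_iff_generator:
  fixes I :: "'a::field poly set"
  assumes I: "left_ideal I"
  shows "lead_coeff b = 1 \<and> b \<in> I \<and> (\<forall>b'. lead_coeff b' = 1 \<and> b' \<in> I \<longrightarrow> degree b \<le> degree b')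
    \<longleftrightarrow> lead_coeff b = 1 \<and> I = left_ideal hull {b}"
proof (intro conj_cong refl iffI)
  assume b: "lead_coeff b = 1"
  assume "b \<in> I \<and> (\<forall>b'. lead_coeff b' = 1 \<and> b' \<in> I \<longrightarrow> degree b \<le> degree b')"
  then have bI: "b \<in> I" and min: "\<And>b'. lead_coeff b' = 1 \<Longrightarrow> b' \<in> I \<Longrightarrow> degree b \<le> degree b'" by auto
  have "b dvd c" if c: "c \<in> I" for c
  proof (rule ccontr)
    assume "\<not> b dvd c"
    then have nz: "c mod b \<noteq> 0" by (simp add: dvd_eq_mod_eq_0)
    let ?r = "smult (inverse (lead_coeff (c mod b))) (c mod b)"
    have "c mod b = c - c div b * b" by (simp add: minus_div_mult_eq_mod)
    then have "c mod b \<in> I"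
      using left_ideal_diff[OF I c left_ideal_mult[OF I bI]] by metis
    then have "?r \<in> I"
      using left_ideal_mult[OF I, of "c mod b" "[:inverse (lead_coeff (c mod b)):]"] by simp
    moreover have "lead_coeff ?r = 1" using nz by simp
    ultimately have "degree b \<le> degree (c mod b)" using min[of ?r] nz by simp
    moreover have "b \<noteq> 0" using b by auto
    ultimately show False using degree_mod_less[of b c] nz by simp
  qed
  moreover have "c \<in> I" if "b dvd c" for c
    using left_ideal_mult[OF I bI] that by (metis dvdE mult.commute)
  ultimately show "I = left_ideal hull {b}" by (auto simp: mem_hull_singleton)
next
  assume b: "lead_coeff b = 1" and "I = left_ideal hull {b}"
  then have mem: "c \<in> I \<longleftrightarrow> b dvd c" for c by (simp add: mem_hull_singleton)
  have "degree b \<le> degree c" if "b dvd c" "lead_coeff c = 1" for c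
    using that by (intro dvd_imp_degree_le) auto
  then show "b \<in> I \<and> (\<forall>b'. lead_coeff b' = 1 \<and> b' \<in> I \<longrightarrow> degree b \<le> degree b')"
    unfolding mem by simp
qed

section \<open>Polynomials in the Euler operator\<close>

lemma weyl_eval_bound:
  "degree b \<le> N \<Longrightarrow> weyl_eval b P = (\<Sum>k\<le>N. weyl_const (coeff b k) * P ^ k)"
proof -
  assume "degree b \<le> N"
  then show ?thesis
    unfolding weyl_eval_def by (intro sum.mono_neutral_left) (auto simp: coeff_eq_0)
qed

lemma weyl_eval_add: "weyl_eval (b + c) P = weyl_eval b P + weyl_eval c P"
proof -
  let ?N = "max (degree b) (degree c)"
  have "degree (b + c) \<le> ?N" "degree b \<le> ?N" "degree c \<le> ?N"
    by (auto intro: degree_add_le)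
  note bounds = this[THEN weyl_eval_bound]
  show ?thesis
    by (simp only: bounds coeff_add weyl_const_add distrib_right sum.distrib)
qed

lemma weyl_eval_smult: "weyl_eval (smult a b) P = weyl_const a * weyl_eval b P"
proof -
  have "weyl_eval (smult a b) P = (\<Sum>k\<le>degree b. weyl_const (coeff (smult a b) k) * P ^ k)"
    by (rule weyl_eval_bound) (rule degree_smult_le)
  then show ?thesis
    by (simp only: weyl_eval_def[of b] coeff_smult weyl_const_mult sum_distrib_left mult.assoc)
qed

lemma weyl_eval_pCons_0: "weyl_eval (pCons 0 b) P = P * weyl_eval b P"
proof -
  have "weyl_eval (pCons 0 b) P = (\<Sum>k\<le>Suc (degree b). weyl_const (coeff (pCons 0 b) k) * P ^ k)"
    by (rule weyl_eval_bound) (rule degree_pCons_le)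
  also have "\<dots> = (\<Sum>k\<le>degree b. weyl_const (coeff b k) * P ^ Suc k)"
    by (subst sum.atMost_Suc_shift) simp
  also have "\<dots> = P * weyl_eval b P"
    unfolding weyl_eval_def sum_distrib_left
  proof (rule sum.cong[OF refl])
    fix k
    have "weyl_const (coeff b k) * (P * P ^ k) = weyl_const (coeff b k) * P * P ^ k"
      by (rule mult.assoc[symmetric])
    also have "\<dots> = P * (weyl_const (coeff b k) * P ^ k)"
      by (simp only: weyl_const_commute[of _ P] mult.assoc)
    finally show "weyl_const (coeff b k) * P ^ Suc k = P * (weyl_const (coeff b k) * P ^ k)" by simp
  qed
  finally show ?thesis .
qed

lemma dy_sigma_dy_poly:
  fixes p :: "'n::{finite,linorder} cpoly"
  shows "dy_sigma * dy_poly p = dy_poly p * (dy_sigma :: ('n, 'r::finite) dy)"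
proof (induction p rule: mult_induct_single)
  case (const a)
  show ?case by (simp only: dy_poly_const weyl_const_commute)
next
  case (mvar j)
  show ?case using sigma_letter[of "Var (Inl j)"] by (simp add: dy_poly_mvar)
next
  case (mult p q)
  have "dy_sigma * (dy_poly p * dy_poly q) = dy_poly p * (dy_sigma * (dy_poly q :: ('n, 'r) dy))"
    using mult(1) by (metis mult.assoc)
  also have "\<dots> = dy_poly p * dy_poly q * dy_sigma"
    using mult(2) by (simp add: mult.assoc)
  finally show ?case by (simp only: dy_poly_mult)
qed (simp_all add: dy_poly_zero dy_poly_add distrib_left distrib_right)

lemma coeff_map_const_mult:
  "coeff (map_poly (Poly_Mapping.single 0) b * [:g:]) k = Poly_Mapping.single 0 (coeff b k) * (g :: 'n::linorder cpoly)"
proof -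
  have "map_poly (Poly_Mapping.single 0) b * [:g:] = smult g (map_poly (Poly_Mapping.single 0) b)"
    by simp
  then have "coeff (map_poly (Poly_Mapping.single 0) b * [:g:]) k = g * Poly_Mapping.single 0 (coeff b k)"
    by (simp only: coeff_smult) (simp add: coeff_map_poly)
  then show ?thesis by (simp only: mult.commute)
qed

lemma degree_map_const_mult_le: "degree (map_poly (Poly_Mapping.single 0) b * [:g :: 'n::linorder cpoly:]) \<le> degree b"
proof (rule degree_le, intro allI impI)
  fix k assume "degree b < k"
  then have "coeff b k = 0" by (rule coeff_eq_0)
  then show "coeff (map_poly (Poly_Mapping.single 0) b * [:g:]) k = 0"
    by (simp only: coeff_map_const_mult) simp
qed

lemma sum_coeff_sigma:
  fixes g :: "'n::{finite,linorder} cpoly" and b :: "complex poly"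
  defines "h \<equiv> map_poly (Poly_Mapping.single 0) b * [:g:]"
  shows "(\<Sum>k\<le>degree h. dy_poly (coeff h k) * dy_sigma ^ k) = weyl_eval b dy_sigma * (dy_poly g :: ('n, 'r::finite) dy)"
proof -
  have "(\<Sum>k\<le>degree h. dy_poly (coeff h k) * dy_sigma ^ k)
      = (\<Sum>k\<le>degree b. dy_poly (coeff h k) * (dy_sigma ^ k :: ('n, 'r) dy))"
    using degree_map_const_mult_le[of b g] by (intro sum.mono_neutral_left) (auto simp: h_def coeff_eq_0 dy_poly_zero)
  also have "\<dots> = weyl_eval b dy_sigma * dy_poly g"
    unfolding weyl_eval_def sum_distrib_right
  proof (rule sum.cong[OF refl])
    fix k
    have "dy_poly (coeff h k) * dy_sigma ^ k = weyl_const (coeff b k) * (dy_poly g * (dy_sigma ^ k :: ('n, 'r) dy))"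
      by (simp only: h_def coeff_map_const_mult dy_poly_mult dy_poly_const mult.assoc)
    also have "dy_poly g * dy_sigma ^ k = dy_sigma ^ k * (dy_poly g :: ('n, 'r) dy)"
      by (rule power_commute) (rule dy_sigma_dy_poly[symmetric])
    finally show "dy_poly (coeff h k) * dy_sigma ^ k = weyl_const (coeff b k) * dy_sigma ^ k * (dy_poly g :: ('n, 'r) dy)"
      by (simp only: mult.assoc)
  qed
  finally show ?thesis .
qed

section \<open>The Bernstein--Sato equation and the eliminated ideal\<close>

context
  fixes f :: "'r::finite \<Rightarrow> 'n::{finite,linorder} cpoly"
  assumes f: "\<And>k. f k \<noteq> 0"
begin

interpretation N: dy_module nf_scale "nf_op f"
  unfolding dy_module_def by (rule weyl_ops_nf[OF f])

lemma nf_act_dy_poly: "nf_act f (dy_poly p) h = nf_coeff (to_fract p) * h"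
proof (induction p arbitrary: h rule: mult_induct_single)
  case zero
  show ?case by (simp add: dy_poly_zero nf_act_eq_weyl_act nf_coeff_simps)
next
  case (const a)
  show ?case by (simp add: dy_poly_const nf_act_const[OF f] nf_scale_def)
next
  case (mvar j)
  show ?case by (simp add: dy_poly_mvar nf_act_var[OF f])
next
  case (add p q)
  have "nf_coeff (to_fract (p + q)) = (nf_coeff (to_fract p) + nf_coeff (to_fract q) :: ('n, 'r) nf)"
    by (simp add: nf_coeff_simps)
  then show ?case using add by (simp add: dy_poly_add nf_act_add[OF f] distrib_right)
next
  case (mult p q)
  have "nf_coeff (to_fract (p * q)) = (nf_coeff (to_fract p) * nf_coeff (to_fract q) :: ('n, 'r) nf)"
    by (simp add: nf_coeff_simps)
  then show ?case using mult by (simp add: dy_poly_mult nf_act_mult[OF f] mult.assoc)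
qed

lemma nf_poly_eq: "nf_poly p = nf_act f (dy_poly p) 1"
  by (simp add: nf_act_dy_poly nf_poly_def)

lemma s_shift_one: "s_shift i c (1 :: ('n, 'r) nf) = 1"
  using s_shift_const[of i c 1] by simp

lemma t_one: "nf_act f (dy_t i) 1 = nf_act f (dy_poly (f i)) 1"
  by (simp add: s_shift_one nf_act_var[OF f] nf_act_dy_poly nf_coeff_simps)

lemma dx_one: "nf_act f (dy_dx j) 1 + (\<Sum>i\<in>UNIV. nf_act f (dy_poly (mpderiv j (f i)) * dy_dt i) 1) = 0"
proof -
  have "nf_act f (dy_poly (mpderiv j (f i)) * dy_dt i) 1
      = - (mvar i * nf_coeff (Fract (mpderiv j (f i)) (f i)))" for i
  proof -
    have "to_fract (mpderiv j (f i)) * Fract 1 (f i) = Fract (mpderiv j (f i)) (f i)"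
      by (simp add: to_fract_def)
    then have "nf_coeff (to_fract (mpderiv j (f i))) * nf_coeff (Fract 1 (f i))
        = (nf_coeff (Fract (mpderiv j (f i)) (f i)) :: ('n, 'r) nf)" by (simp add: nf_coeff_simps)
    then show ?thesis
      by (simp add: s_shift_one nf_act_mult[OF f] nf_act_dy_poly nf_act_der[OF f] mult.left_commute[of _ "mvar i"])
  qed
  moreover have "nf_act f (dy_dx j) 1 = nf_log_deriv f j"
    using map_deriv_single[of j "0 :: 'r \<Rightarrow>\<^sub>0 nat" 1] by (simp add: nf_act_der[OF f] nf_coeff_simps)
  ultimately show ?thesis by (simp add: nf_log_deriv_def sum_negf)
qed

lemma bernstein_sato_eq_iff:
  "bernstein_sato_eq f g b \<longleftrightarrow> (\<exists>P. (\<forall>j. P j \<in> dx_dt_t_subalgebra) \<and>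
     nf_act f (weyl_eval b dy_sigma * dy_poly g) 1 = (\<Sum>j\<in>UNIV. nf_act f (P j * dy_poly (g * f j)) 1))"
  unfolding bernstein_sato_eq_def nf_poly_eq nf_act_mult[OF f] ..

text \<open>The equation can be multiplied from the left by operators of degree zero, such as \<open>\<sigma>\<close>.\<close>

lemma left_ideal_bernstein_sato: "left_ideal {b. bernstein_sato_eq f g b}"
proof -
  have zero: "bernstein_sato_eq f g 0"
    unfolding bernstein_sato_eq_iff
    by (intro exI[of _ "\<lambda>j. 0"]) (simp add: degree_zero_zero weyl_eval_def N.zero_left nf_act_eq_weyl_act)
  have add: "bernstein_sato_eq f g (b + c)" if bc: "bernstein_sato_eq f g b" "bernstein_sato_eq f g c" for b c
  proof -
    from bc obtain P Q where "\<forall>j. P j \<in> dx_dt_t_subalgebra" "\<forall>j. Q j \<in> dx_dt_t_subalgebra"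
      "nf_act f (weyl_eval b dy_sigma * dy_poly g) 1 = (\<Sum>j\<in>UNIV. nf_act f (P j * dy_poly (g * f j)) 1)"
      "nf_act f (weyl_eval c dy_sigma * dy_poly g) 1 = (\<Sum>j\<in>UNIV. nf_act f (Q j * dy_poly (g * f j)) 1)"
      unfolding bernstein_sato_eq_iff by auto
    then show ?thesis
      unfolding bernstein_sato_eq_iff
      by (intro exI[of _ "\<lambda>j. P j + Q j"])
        (simp add: degree_zero_add weyl_eval_add distrib_right nf_act_add[OF f] sum.distrib)
  qed
  have op: "bernstein_sato_eq f g c"
    if b: "bernstein_sato_eq f g b" and T: "T \<in> dx_dt_t_subalgebra"
      and c: "weyl_eval c dy_sigma = T * weyl_eval b dy_sigma" for b c and T :: "('n, 'r) dy"
  proof -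
    from b obtain P where "\<forall>j. P j \<in> dx_dt_t_subalgebra"
      "nf_act f (weyl_eval b dy_sigma * dy_poly g) 1 = (\<Sum>j\<in>UNIV. nf_act f (P j * dy_poly (g * f j)) 1)"
      unfolding bernstein_sato_eq_iff by auto
    then show ?thesis
      unfolding bernstein_sato_eq_iff
      by (intro exI[of _ "\<lambda>j. T * P j"])
        (simp add: c degree_zero_mult T mult.assoc nf_act_eq_weyl_act N.mult[of T] N.sum_right)
  qed
  have "bernstein_sato_eq f g (c * b)" if b: "bernstein_sato_eq f g b" for b c
  proof (induction c)
    case (pCons a c)
    have "bernstein_sato_eq f g (smult a b)"
      by (rule op[OF b degree_zero_const]) (rule weyl_eval_smult)
    moreover have "bernstein_sato_eq f g (pCons 0 (c * b))"
      by (rule op[OF pCons(2) degree_zero_sigma]) (rule weyl_eval_pCons_0)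
    ultimately show ?case by (simp add: mult_pCons_left add)
  qed (simp add: zero)
  then show ?thesis using zero add by (simp add: left_ideal_def)
qed

text \<open>From the ideal to the equation, the membership is evaluated at \<open>\<Prod>\<^sub>i f\<^sub>i^s\<^sub>i\<close> in the graded module.
  Conversely, the difference \<open>R\<close> of the two sides of the equation is an operator of degree zero
  that kills \<open>\<Prod>\<^sub>i f\<^sub>i^s\<^sub>i\<close>, hence lies in \<open>ideal_1 f\<close>, and \<open>s\<^sup>k\<close> may be exchanged for \<open>\<sigma>\<^sup>k\<close> modulo
  \<open>s - \<sigma>\<close>.\<close>

lemma ideal_4_iff: "b \<in> ideal_4 f g \<longleftrightarrow> bernstein_sato_eq f g b"
proof -
  define h where "h = map_poly (Poly_Mapping.single 0) b * [:g:]"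
  define H where "H = left_ideal hull
     (dys ` ideal_1 f \<union> (\<lambda>a. dys (dy_poly (g * a))) ` (left_ideal hull (range f))
      \<union> {Poly_Mapping.single 1 1 - dys dy_sigma :: nat \<Rightarrow>\<^sub>0 ('n, 'r) dy})"
  have mem: "b \<in> ideal_4 f g \<longleftrightarrow> dys_poly h \<in> H"
    by (simp add: ideal_4_def ideal_3_def ideal_2_def colon_ideal_def h_def H_def)
  have sum_h: "(\<Sum>k\<le>degree h. dy_poly (coeff h k) * dy_sigma ^ k) = weyl_eval b dy_sigma * (dy_poly g :: ('n, 'r) dy)"
    unfolding h_def by (rule sum_coeff_sigma)
  show ?thesis
  proof
    assume "b \<in> ideal_4 f g"
    then have "dys_poly h \<in> H" by (simp add: mem)
    from N.eval_at_sigma_mem[OF t_one[unfolded nf_act_eq_weyl_act] dx_one[unfolded nf_act_eq_weyl_act] this[unfolded H_def]]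
    obtain P where P: "\<forall>j. P j \<in> dx_dt_t_subalgebra"
      "(\<Sum>k\<le>degree h. N.act (dy_poly (coeff h k) * dy_sigma ^ k) 1) = (\<Sum>j\<in>UNIV. N.act (P j * dy_poly (g * f j)) 1)"
      by blast
    then have "N.act (weyl_eval b dy_sigma * dy_poly g) 1 = (\<Sum>j\<in>UNIV. N.act (P j * dy_poly (g * f j)) 1)"
      by (simp only: sum_h flip: N.sum_left)
    with P(1) show "bernstein_sato_eq f g b"
      unfolding bernstein_sato_eq_iff nf_act_eq_weyl_act by blast
  next
    assume "bernstein_sato_eq f g b"
    then obtain P where P: "\<forall>j. P j \<in> dx_dt_t_subalgebra"
      "N.act (weyl_eval b dy_sigma * dy_poly g) 1 = (\<Sum>j\<in>UNIV. N.act (P j * dy_poly (g * f j)) 1)"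
      unfolding bernstein_sato_eq_iff nf_act_eq_weyl_act by blast
    define R where "R = weyl_eval b dy_sigma * dy_poly g - (\<Sum>j\<in>UNIV. P j * dy_poly (g * f j))"
    have H: "left_ideal H" unfolding H_def by (rule left_ideal_hull)
    have "R \<in> dx_dt_t_subalgebra"
      unfolding R_def weyl_eval_def diff_conv_add_uminus
      by (intro degree_zero_add degree_zero_uminus degree_zero_sum degree_zero_mult degree_zero_const
          degree_zero_power degree_zero_sigma degree_zero_dy_poly) (use P in auto)
    moreover have "N.act R 1 = 0" using P(2) by (simp add: R_def N.diff_left N.sum_left)
    ultimately have "R \<in> ideal_1 f"
      by (intro N.degree_zero_annihilator[OF t_one[unfolded nf_act_eq_weyl_act] dx_one[unfolded nf_act_eq_weyl_act]]) simp_all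
    then have RH: "dys R \<in> H" unfolding H_def by (intro hull_inc) blast
    have "f j \<in> left_ideal hull (range f)" for j by (rule hull_inc) simp
    then have fH: "dys (dy_poly (g * f j)) \<in> H" for j unfolding H_def by (intro hull_inc) blast
    have sH: "Poly_Mapping.single 1 1 - dys dy_sigma \<in> H" unfolding H_def by (intro hull_inc) blast
    have powH: "Poly_Mapping.single k 1 - dys (dy_sigma ^ k) \<in> H" for k
    proof (induction k)
      case 0
      show ?case using left_ideal_0[OF H] by simp
    next
      case (Suc k)
      have "Poly_Mapping.single 1 1 * (Poly_Mapping.single k 1 - dys (dy_sigma ^ k))
          + dys (dy_sigma ^ k) * (Poly_Mapping.single 1 1 - dys dy_sigma) \<in> H"
        by (intro left_ideal_add[OF H] left_ideal_mult[OF H] Suc sH)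
      then show ?case
        by (simp add: right_diff_distrib mult_single power_commutes)
    qed
    have "(\<Sum>k\<le>degree h. dys (dy_poly (coeff h k)) * (Poly_Mapping.single k 1 - dys (dy_sigma ^ k)))
        + (dys R + (\<Sum>j\<in>UNIV. dys (P j) * dys (dy_poly (g * f j)))) \<in> H"
      by (intro left_ideal_add[OF H] left_ideal_sum[OF H] left_ideal_mult[OF H] powH RH fH)
    moreover have "(\<Sum>k\<le>degree h. dys (dy_poly (coeff h k)) * (Poly_Mapping.single k 1 - dys (dy_sigma ^ k)))
        = dys_poly h - dys (weyl_eval b dy_sigma * dy_poly g :: ('n, 'r) dy)"
      by (simp add: right_diff_distrib mult_single sum_subtractf dys_poly_def single_0_sum flip: sum_h)
    moreover have "dys R + (\<Sum>j\<in>UNIV. dys (P j) * dys (dy_poly (g * f j)))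
        = dys (weyl_eval b dy_sigma * dy_poly g)"
      by (simp add: R_def mult_single flip: single_add single_0_sum)
    ultimately show "b \<in> ideal_4 f g" by (simp add: mem)
  qed
qed

end

text \<open>The first part only spells out that every multiple \<open>q g\<close> lies in the ideal generated by \<open>g\<close>.
  The second follows from \<open>ideal_4_iff\<close>, as an ideal of polynomials in one variable over a
  field is generated by its monic element of least degree.\<close>

theorem theorem3p4:
  fixes f :: "'r::finite \<Rightarrow> 'n::{finite,linorder} cpoly"
    and g :: "'n cpoly"
  assumes "\<forall>i. f i \<noteq> 0" and "g \<noteq> 0"
  shows "ideal_3 f g = {q. \<exists>h \<in> ideal_2 f g \<inter> (left_ideal hull {[:g:]}). h = q * [:g:]} \<and>
    (\<forall>b. is_bernstein_sato f g b \<longleftrightarrow> lead_coeff b = 1 \<and> ideal_4 f g = left_ideal hull {b})"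
proof (intro conjI allI)
  show "ideal_3 f g = {q. \<exists>h \<in> ideal_2 f g \<inter> (left_ideal hull {[:g:]}). h = q * [:g:]}"
    by (auto simp: ideal_3_def colon_ideal_def mem_hull_singleton simp del: mult_pCons_right)
next
  fix b
  have f: "\<And>k. f k \<noteq> 0" using assms by blast
  have eq: "ideal_4 f g = {b. bernstein_sato_eq f g b}" using ideal_4_iff[where f=f, OF f] by blast
  have "left_ideal (ideal_4 f g)" unfolding eq by (rule left_ideal_bernstein_sato[where f=f, OF f])
  from minimal_monic_iff_generator[OF this, of b]
  show "is_bernstein_sato f g b \<longleftrightarrow> lead_coeff b = 1 \<and> ideal_4 f g = left_ideal hull {b}"
    by (simp add: is_bernstein_sato_def ideal_4_iff[where f=f, OF f])
qed

end
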